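(* Neither the extended generalized octagon on $2048$ points related to ${\it He}$ nor the extended generalized octagon on $112$ points related to $2\cdot L_3(4).2^2$ admits an extension: there is no connected incidence system $\Gamma$ all of whose point residues are isomorphic to one of these two extended generalized octagons.
   Context: An incidence system has points and blocks (subsets of size $\ge2$); the residue $\Gamma_u$ of a point $u$ has points those adjacent to and distinct from $u$ and blocks $B-\{u\}$ for $u\in B$; an extension of a class $\mathcal D$ is a connected incidence system all of whose point residues are isomorphic to members of $\mathcal D$. The two extended generalized octagons are the extensions of the flag generalized octagons $W(4)^F$ (with automorphism group ${\it He}$, $2048$ points) and $W(2)^F$ (with automorphism group $2\cdot L_3(4).2^2$, $112$ points) satisfying: the points of a triple $\{u,v,w\}$ not in a block are pairwise adjacent iff $v,w$ are at distance $3$ in the point graph of $\Gamma_u$. *)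

theory Defs
  imports Main
begin

type_synonym 'a incsys = "'a set \<times> 'a set set"

definition incidence_system :: "'a incsys \<Rightarrow> bool" where
  "incidence_system \<Gamma> \<longleftrightarrow> (\<forall>b\<in>snd \<Gamma>. b \<subseteq> fst \<Gamma> \<and> finite b \<and> card b \<ge> 2)"

definition adjacent :: "'a incsys \<Rightarrow> 'a \<Rightarrow> 'a \<Rightarrow> bool" where
  "adjacent \<Gamma> u v \<longleftrightarrow> u \<in> fst \<Gamma> \<and> v \<in> fst \<Gamma> \<and> u \<noteq> v \<and> (\<exists>b\<in>snd \<Gamma>. u \<in> b \<and> v \<in> b)"

definition connected_is :: "'a incsys \<Rightarrow> bool" where
  "connected_is \<Gamma> \<longleftrightarrow> fst \<Gamma> \<noteq> {} \<and>
     (\<forall>u\<in>fst \<Gamma>. \<forall>v\<in>fst \<Gamma>. (adjacent \<Gamma>)\<^sup>*\<^sup>* u v)"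

definition residue :: "'a incsys \<Rightarrow> 'a \<Rightarrow> 'a incsys" where
  "residue \<Gamma> u = ({v \<in> fst \<Gamma>. adjacent \<Gamma> u v}, {b - {u} | b. b \<in> snd \<Gamma> \<and> u \<in> b})"

definition iso_is :: "'a incsys \<Rightarrow> 'b incsys \<Rightarrow> bool" where
  "iso_is \<Gamma> \<Delta> \<longleftrightarrow> (\<exists>f. bij_betw f (fst \<Gamma>) (fst \<Delta>) \<and> (image f) ` snd \<Gamma> = snd \<Delta>)"

definition dist3 :: "'a incsys \<Rightarrow> 'a \<Rightarrow> 'a \<Rightarrow> bool" where
  "dist3 \<Gamma> v w \<longleftrightarrow> (adjacent \<Gamma> ^^ 3) v w \<and> (\<forall>k<3. \<not> (adjacent \<Gamma> ^^ k) v w)"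

text \<open>A field is given by explicit operations on a type all of whose elements are
field elements: addition, negation, multiplication, zero.  Vectors of the
4-dimensional space are quadruples.\<close>

type_synonym 'f vec4 = "'f \<times> 'f \<times> 'f \<times> 'f"

fun vadd :: "('f \<Rightarrow> 'f \<Rightarrow> 'f) \<Rightarrow> 'f vec4 \<Rightarrow> 'f vec4 \<Rightarrow> 'f vec4" where
  "vadd ad (a1,a2,a3,a4) (b1,b2,b3,b4) = (ad a1 b1, ad a2 b2, ad a3 b3, ad a4 b4)"

fun smul :: "('f \<Rightarrow> 'f \<Rightarrow> 'f) \<Rightarrow> 'f \<Rightarrow> 'f vec4 \<Rightarrow> 'f vec4" where
  "smul mu k (a1,a2,a3,a4) = (mu k a1, mu k a2, mu k a3, mu k a4)"

fun symp :: "('f \<Rightarrow> 'f \<Rightarrow> 'f) \<Rightarrow> ('f \<Rightarrow> 'f) \<Rightarrow> ('f \<Rightarrow> 'f \<Rightarrow> 'f) \<Rightarrow> 'f vec4 \<Rightarrow> 'f vec4 \<Rightarrow> 'f" where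
  "symp ad ng mu (a1,a2,a3,a4) (b1,b2,b3,b4) =
     ad (ad (mu a1 b2) (ng (mu a2 b1))) (ad (mu a3 b4) (ng (mu a4 b3)))"

definition span1 :: "('f \<Rightarrow> 'f \<Rightarrow> 'f) \<Rightarrow> 'f vec4 \<Rightarrow> 'f vec4 set" where
  "span1 mu v = {smul mu k v | k. True}"

definition span2 :: "('f \<Rightarrow> 'f \<Rightarrow> 'f) \<Rightarrow> ('f \<Rightarrow> 'f \<Rightarrow> 'f) \<Rightarrow> 'f vec4 \<Rightarrow> 'f vec4 \<Rightarrow> 'f vec4 set" where
  "span2 ad mu v w = {vadd ad (smul mu a v) (smul mu b w) | a b. True}"

definition pg_points :: "('f \<Rightarrow> 'f \<Rightarrow> 'f) \<Rightarrow> 'f \<Rightarrow> 'f vec4 set set" where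
  "pg_points mu z = {span1 mu v | v. v \<noteq> (z,z,z,z)}"

definition pg_lines :: "('f \<Rightarrow> 'f \<Rightarrow> 'f) \<Rightarrow> ('f \<Rightarrow> 'f \<Rightarrow> 'f) \<Rightarrow> 'f \<Rightarrow> 'f vec4 set set" where
  "pg_lines ad mu z = {span2 ad mu v w | v w. v \<noteq> (z,z,z,z) \<and> w \<notin> span1 mu v}"

text \<open>Lines of W(q): totally isotropic lines.  (All points are isotropic.)\<close>
definition W_lines :: "('f \<Rightarrow> 'f \<Rightarrow> 'f) \<Rightarrow> ('f \<Rightarrow> 'f) \<Rightarrow> ('f \<Rightarrow> 'f \<Rightarrow> 'f) \<Rightarrow> 'f \<Rightarrow> 'f vec4 set set" where
  "W_lines ad ng mu z = {L \<in> pg_lines ad mu z. \<forall>x\<in>L. \<forall>y\<in>L. symp ad ng mu x y = z}"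

definition W_flags :: "('f \<Rightarrow> 'f \<Rightarrow> 'f) \<Rightarrow> ('f \<Rightarrow> 'f) \<Rightarrow> ('f \<Rightarrow> 'f \<Rightarrow> 'f) \<Rightarrow> 'f
     \<Rightarrow> ('f vec4 set \<times> 'f vec4 set) set" where
  "W_flags ad ng mu z = {(P, L). P \<in> pg_points mu z \<and> L \<in> W_lines ad ng mu z \<and> P \<subseteq> L}"

definition flag_octagon :: "('f \<Rightarrow> 'f \<Rightarrow> 'f) \<Rightarrow> ('f \<Rightarrow> 'f) \<Rightarrow> ('f \<Rightarrow> 'f \<Rightarrow> 'f) \<Rightarrow> 'f
     \<Rightarrow> ('f vec4 set \<times> 'f vec4 set) incsys" where
  "flag_octagon ad ng mu z =
     (W_flags ad ng mu z,
      {{f \<in> W_flags ad ng mu z. fst f = P} | P. P \<in> pg_points mu z} \<union>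
      {{f \<in> W_flags ad ng mu z. snd f = L} | L. L \<in> W_lines ad ng mu z})"

definition W2F :: "((bool vec4) set \<times> (bool vec4) set) incsys" where
  "W2F = flag_octagon (\<lambda>x y. x \<noteq> y) id (\<and>) False"

text \<open>GF(4) = {a + b\<omega>} with \<omega>^2 = \<omega> + 1, coded as pairs of booleans.\<close>
fun gf4_add :: "bool \<times> bool \<Rightarrow> bool \<times> bool \<Rightarrow> bool \<times> bool" where
  "gf4_add (a,b) (c,d) = (a \<noteq> c, b \<noteq> d)"

fun gf4_mul :: "bool \<times> bool \<Rightarrow> bool \<times> bool \<Rightarrow> bool \<times> bool" where
  "gf4_mul (a,b) (c,d) = ((a \<and> c) \<noteq> (b \<and> d), ((a \<and> d) \<noteq> (b \<and> c)) \<noteq> (b \<and> d))"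

definition W4F :: "(((bool \<times> bool) vec4) set \<times> ((bool \<times> bool) vec4) set) incsys" where
  "W4F = flag_octagon gf4_add id gf4_mul (False, False)"

definition triangle_cond :: "'a incsys \<Rightarrow> bool" where
  "triangle_cond \<Gamma> \<longleftrightarrow>
    (\<forall>u\<in>fst \<Gamma>. \<forall>v\<in>fst \<Gamma>. \<forall>w\<in>fst \<Gamma>.
       u \<noteq> v \<and> u \<noteq> w \<and> v \<noteq> w \<and> \<not> (\<exists>b\<in>snd \<Gamma>. {u,v,w} \<subseteq> b) \<longrightarrow>
       ((adjacent \<Gamma> u v \<and> adjacent \<Gamma> u w \<and> adjacent \<Gamma> v w) \<longleftrightarrow>
        (v \<in> fst (residue \<Gamma> u) \<and> w \<in> fst (residue \<Gamma> u) \<and> dist3 (residue \<Gamma> u) v w)))"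

definition extension_of :: "'a incsys \<Rightarrow> 'b incsys \<Rightarrow> bool" where
  "extension_of \<Gamma> \<Delta> \<longleftrightarrow> incidence_system \<Gamma> \<and> connected_is \<Gamma> \<and>
     (\<forall>u\<in>fst \<Gamma>. iso_is (residue \<Gamma> u) \<Delta>)"

definition ext_oct_He :: "'a incsys \<Rightarrow> bool" where
  "ext_oct_He \<Gamma> \<longleftrightarrow> extension_of \<Gamma> W4F \<and> triangle_cond \<Gamma>"

definition ext_oct_L34 :: "'a incsys \<Rightarrow> bool" where
  "ext_oct_L34 \<Gamma> \<longleftrightarrow> extension_of \<Gamma> W2F \<and> triangle_cond \<Gamma>"

end

theory Submission
  imports Defs "HOL-Library.Cardinality" "HOL-Library.Z2"
begin

text \<open>
  In an octagon call two points odd if their distance is 1 or 3. By the triangle condition, two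
  neighbours of a point n of an extended octagon are adjacent exactly if they are odd in the residue
  of n; adjacency thus translates between different residues.

  Take a block B of an extended octagon and m in B, and let Y be the set of points adjacent to all
  of B except m. Seen from any n in B - {m}, these are the points with gate m on the line B - {n},
  so there are q^2 of them, and each y in Y is joined to q - 1 others by blocks through n.
  The contributions of the q + 1 choices of n are disjoint, hence Y together with B - {m} is a
  projective plane of order q and any two points of Y lie in a block with a unique n.
  Now let z be a point adjacent to all of B except i, where i differs from m, and let y1, y2 in Y be
  adjacent to z. Since an octagon has no short circuits, no n other than i can join y1 and y2. So
  i, y1, y2 lie in a common block.

  In an extension, let u and v be adjacent. Choose such a configuration in the octagon of the pair
  u, v, and apply the above to the residue of u and to the residue of v: both u, i, y1, y2 and
  v, i, y1, y2 lie in blocks. In the octagon of the pair i, y1 the points u and v are then odd and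
  both collinear with y2, hence collinear, so u, v, i, y1 lie in a block. But i and y1 are at
  distance 3 in the octagon of u, v.
\<close>

section \<open>Generalized quadrangles and their flag octagons\<close>

definition odd_rel :: "'a incsys \<Rightarrow> 'a \<Rightarrow> 'a \<Rightarrow> bool" where
  "odd_rel \<Omega> x y \<longleftrightarrow> adjacent \<Omega> x y \<or> dist3 \<Omega> x y"

text \<open>In a generalized octagon the following are the points whose nearest point on the line b
  is m, at distance 2.\<close>

definition gate_set :: "'a incsys \<Rightarrow> 'a set \<Rightarrow> 'a \<Rightarrow> 'a set" where
  "gate_set \<Omega> b m = {y \<in> fst \<Omega>. y \<noteq> m \<and> \<not> odd_rel \<Omega> y m \<and> (\<forall>n\<in>b - {m}. odd_rel \<Omega> y n)}"

lemma dist3_iff: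
  "dist3 \<Omega> x y \<longleftrightarrow> (\<exists>a c. adjacent \<Omega> x a \<and> adjacent \<Omega> a c \<and> adjacent \<Omega> c y) \<and>
     x \<noteq> y \<and> \<not> adjacent \<Omega> x y \<and> \<not> (\<exists>a. adjacent \<Omega> x a \<and> adjacent \<Omega> a y)"
proof -
  have *: "(\<forall>k<3. \<not> P k) \<longleftrightarrow> \<not> P 0 \<and> \<not> P 1 \<and> \<not> P 2" for P :: "nat \<Rightarrow> bool"
    by (auto simp: numeral_3_eq_3 numeral_2_eq_2 less_Suc_eq)
  show ?thesis
    unfolding dist3_def *
    by (auto simp: numeral_3_eq_3 numeral_2_eq_2 relcompp_apply)
qed

lemma adjacent_sym: "adjacent \<Omega> x y \<longleftrightarrow> adjacent \<Omega> y x"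
  by (auto simp: adjacent_def)

text \<open>A common neighbour excludes distance 3, so only collinearity is left. The extension
  argument obtains new common blocks in this way.\<close>

lemma odd_rel_common_neighbour:
  assumes "odd_rel \<Omega> x y" "adjacent \<Omega> x a" "adjacent \<Omega> a y"
  shows "adjacent \<Omega> x y"
  using assms by (auto simp: odd_rel_def dist3_iff)

lemma odd_rel_irrefl: "\<not> odd_rel \<Omega> x x"
  by (auto simp: odd_rel_def dist3_iff adjacent_def)

lemma ex_outside: "finite F \<Longrightarrow> card F < card S \<Longrightarrow> \<exists>x\<in>S. x \<notin> F"
  by (meson card_mono leD subsetI)

section \<open>Generalized quadrangles with k points per line and k lines per point\<close>

locale gen_quadrangle =
  fixes Pt :: "'p set" and Ln :: "'l set" and I :: "'p \<Rightarrow> 'l \<Rightarrow> bool" and k :: nat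
  assumes join_unique:
      "\<lbrakk>p \<in> Pt; q \<in> Pt; l \<in> Ln; m \<in> Ln; I p l; I q l; I p m; I q m\<rbrakk> \<Longrightarrow> p = q \<or> l = m"
    and proj_ex: "\<lbrakk>p \<in> Pt; l \<in> Ln; \<not> I p l\<rbrakk> \<Longrightarrow> \<exists>q\<in>Pt. \<exists>m\<in>Ln. I p m \<and> I q m \<and> I q l"
    and proj_unique: "\<lbrakk>p \<in> Pt; l \<in> Ln; \<not> I p l; q \<in> Pt; m \<in> Ln; I p m; I q m; I q l;
         q' \<in> Pt; m' \<in> Ln; I p m'; I q' m'; I q' l\<rbrakk> \<Longrightarrow> q = q' \<and> m = m'"
    and card_line: "l \<in> Ln \<Longrightarrow> card {p \<in> Pt. I p l} = k"
    and card_pencil: "p \<in> Pt \<Longrightarrow> card {l \<in> Ln. I p l} = k"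
    and k_ge_3: "3 \<le> k"
    and Pt_nonempty: "Pt \<noteq> {}"
    and Ln_nonempty: "Ln \<noteq> {}"

text \<open>The axioms are self-dual because incidence is an arbitrary relation and lines and
  pencils have the same size k. Each result on pencils thereby also gives one on lines.\<close>

lemma gen_quadrangle_dual:
  assumes "gen_quadrangle Pt Ln I k"
  shows "gen_quadrangle Ln Pt (\<lambda>l p. I p l) k"
proof -
  interpret gen_quadrangle Pt Ln I k by fact
  show ?thesis
  proof
    fix p l q m q' m'
    assume "p \<in> Ln" "l \<in> Pt" "\<not> I l p" "q \<in> Ln" "m \<in> Pt" "I m p" "I m q" "I l q"
      "q' \<in> Ln" "m' \<in> Pt" "I m' p" "I m' q'" "I l q'"
    then show "q = q' \<and> m = m'" using proj_unique[of l p m q m' q'] by blast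
  next
    fix p q l m
    assume "p \<in> Ln" "q \<in> Ln" "l \<in> Pt" "m \<in> Pt" "I l p" "I l q" "I m p" "I m q"
    then show "p = q \<or> l = m" using join_unique[of l m p q] by blast
  next
    fix p l
    assume "p \<in> Ln" "l \<in> Pt" "\<not> I l p"
    then show "\<exists>q\<in>Ln. \<exists>m\<in>Pt. I m p \<and> I m q \<and> I l q" using proj_ex[of l p] by blast
  qed (use card_line card_pencil k_ge_3 Pt_nonempty Ln_nonempty in auto)
qed

text \<open>The points of \<open>\<Omega>\<close> are only labelled by flags, through
  \<open>pt\<close> and \<open>ln\<close>. Thus the results apply directly to any isomorphic copy of
  a flag octagon, such as a residue.\<close>

locale flag_system = gen_quadrangle Pt Ln I k
  for Pt :: "'p set" and Ln :: "'l set" and I k +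
  fixes \<Omega> :: "'a incsys" and pt :: "'a \<Rightarrow> 'p" and ln :: "'a \<Rightarrow> 'l"
  assumes pt_in: "x \<in> fst \<Omega> \<Longrightarrow> pt x \<in> Pt"
    and ln_in: "x \<in> fst \<Omega> \<Longrightarrow> ln x \<in> Ln"
    and pt_on_ln: "x \<in> fst \<Omega> \<Longrightarrow> I (pt x) (ln x)"
    and flag_inj: "\<lbrakk>x \<in> fst \<Omega>; y \<in> fst \<Omega>; pt x = pt y; ln x = ln y\<rbrakk> \<Longrightarrow> x = y"
    and flag_ex: "\<lbrakk>p \<in> Pt; l \<in> Ln; I p l\<rbrakk> \<Longrightarrow> \<exists>x\<in>fst \<Omega>. pt x = p \<and> ln x = l"
    and blocks: "snd \<Omega> = {{x \<in> fst \<Omega>. pt x = p} | p. p \<in> Pt} \<union> {{x \<in> fst \<Omega>. ln x = l} | l. l \<in> Ln}"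

lemma flag_system_dual:
  assumes "flag_system Pt Ln I k \<Omega> pt ln"
  shows "flag_system Ln Pt (\<lambda>l p. I p l) k \<Omega> ln pt"
proof -
  interpret flag_system Pt Ln I k \<Omega> pt ln by fact
  interpret d: gen_quadrangle Ln Pt "\<lambda>l p. I p l" k
    by (rule gen_quadrangle_dual) unfold_locales
  show ?thesis
  proof
    fix p l assume "p \<in> Ln" "l \<in> Pt" "I l p"
    then show "\<exists>x\<in>fst \<Omega>. ln x = p \<and> pt x = l" using flag_ex[of l p] by blast
  next
    show "snd \<Omega> = {{x \<in> fst \<Omega>. ln x = p} |p. p \<in> Ln} \<union> {{x \<in> fst \<Omega>. pt x = l} |l. l \<in> Pt}"
      by (subst blocks) (rule Un_commute)
  qed (use pt_in ln_in pt_on_ln flag_inj in auto)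
qed

section \<open>Distances between flags\<close>

context flag_system
begin

lemma adjacent_iff:
  assumes "x \<in> fst \<Omega>" "y \<in> fst \<Omega>"
  shows "adjacent \<Omega> x y \<longleftrightarrow> x \<noteq> y \<and> (pt x = pt y \<or> ln x = ln y)"
proof -
  have "(\<exists>b\<in>snd \<Omega>. x \<in> b \<and> y \<in> b) \<longleftrightarrow> pt x = pt y \<or> ln x = ln y"
    (is "?l \<longleftrightarrow> ?r")
  proof
    assume ?l
    then obtain b where "b \<in> snd \<Omega>" and b: "x \<in> b" "y \<in> b" by blast
    then consider p where "b = {z \<in> fst \<Omega>. pt z = p}" | l where "b = {z \<in> fst \<Omega>. ln z = l}"
      unfolding blocks by blast
    then show ?r by cases (use b in auto)
  next
    have "{z \<in> fst \<Omega>. pt z = pt x} \<in> snd \<Omega>" "{z \<in> fst \<Omega>. ln z = ln x} \<in> snd \<Omega>"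
      unfolding blocks using pt_in[OF assms(1)] ln_in[OF assms(1)] by blast+
    moreover assume ?r
    ultimately show ?l using assms by (metis (mono_tags, lifting) mem_Collect_eq)
  qed
  then show ?thesis using assms by (auto simp: adjacent_def)
qed

text \<open>The line n is the middle of a path x, (\<open>pt x\<close>, n), (\<open>pt y\<close>,
  n), y of flags; \<open>third_point\<close> describes the dual path. These are the two shapes of a
  geodesic of length 3.\<close>

definition third_line where
  "third_line x y \<longleftrightarrow> (\<exists>n\<in>Ln. I (pt x) n \<and> I (pt y) n \<and> n \<noteq> ln x \<and> n \<noteq> ln y)"

definition third_point where
  "third_point x y \<longleftrightarrow> (\<exists>r\<in>Pt. I r (ln x) \<and> I r (ln y) \<and> r \<noteq> pt x \<and> r \<noteq> pt y)"

text \<open>A path of length 2 between flags sharing neither point nor line passes through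
  (\<open>pt x\<close>, \<open>ln y\<close>) or (\<open>pt y\<close>, \<open>ln x\<close>). Either
  of these flags would put two distinct points on two distinct lines.\<close>

lemma no_short_path:
  assumes x: "x \<in> fst \<Omega>" and y: "y \<in> fst \<Omega>" and ne: "pt x \<noteq> pt y" "ln x \<noteq> ln y"
    and t: "third_line x y \<or> third_point x y"
  shows "\<not> I (pt x) (ln y)" "\<not> I (pt y) (ln x)"
proof -
  note m = pt_in[OF x] pt_in[OF y] ln_in[OF x] ln_in[OF y] pt_on_ln[OF x] pt_on_ln[OF y]
  show "\<not> I (pt x) (ln y)"
    using t m ne join_unique unfolding third_line_def third_point_def by metis
  show "\<not> I (pt y) (ln x)"
    using t m ne join_unique unfolding third_line_def third_point_def by metis
qed

lemma odd_rel_iff: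
  assumes x: "x \<in> fst \<Omega>" and y: "y \<in> fst \<Omega>"
  shows "odd_rel \<Omega> x y \<longleftrightarrow> x \<noteq> y \<and>
    (pt x = pt y \<or> ln x = ln y \<or> third_line x y \<or> third_point x y)" (is "_ \<longleftrightarrow> ?R")
proof
  assume o: "odd_rel \<Omega> x y"
  show ?R
  proof (cases "adjacent \<Omega> x y")
    case True then show ?thesis using x y by (auto simp: adjacent_iff)
  next
    case False
    with o obtain a c where ac: "adjacent \<Omega> x a" "adjacent \<Omega> a c" "adjacent \<Omega> c y" "x \<noteq> y"
      and n: "\<And>a. \<not> (adjacent \<Omega> x a \<and> adjacent \<Omega> a y)"
      by (auto simp: odd_rel_def dist3_iff)
    have in': "a \<in> fst \<Omega>" "c \<in> fst \<Omega>" using ac by (auto simp: adjacent_def)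
    note ai = adjacent_iff[OF x in'(1)] adjacent_iff[OF in'] adjacent_iff[OF in'(2) y]
      adjacent_iff[OF x in'(2)] adjacent_iff[OF in'(1) y]
    note m = pt_on_ln[OF x] pt_on_ln[OF y] pt_on_ln[OF in'(1)] pt_on_ln[OF in'(2)]
      pt_in[OF in'(1)] ln_in[OF in'(1)]
    \<comment> \<open>Two consecutive steps keeping the same component could be merged into one,
      giving a shorter path. So the kept components alternate, which leaves the two shapes.\<close>
    have n1: "\<not> adjacent \<Omega> a y" "\<not> adjacent \<Omega> x c" using n ac by blast+
    have "x \<noteq> c" "a \<noteq> y" using ac False by (auto simp: adjacent_sym)
    then show ?thesis
      using ac n1 m False x y in' unfolding ai adjacent_iff[OF x y] third_line_def third_point_def
      by metis
  qed
next
  assume r: ?R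
  show "odd_rel \<Omega> x y"
  proof (cases "pt x = pt y \<or> ln x = ln y")
    case True then show ?thesis using r x y by (auto simp: odd_rel_def adjacent_iff)
  next
    case False
    then have ne: "pt x \<noteq> pt y" "ln x \<noteq> ln y" and t: "third_line x y \<or> third_point x y"
      using r by auto
    note ns = no_short_path[OF x y ne t]
    have nadj: "\<not> adjacent \<Omega> x y" using ne x y by (auto simp: adjacent_iff)
    have n2: "\<not> (adjacent \<Omega> x a \<and> adjacent \<Omega> a y)" for a
    proof
      assume a: "adjacent \<Omega> x a \<and> adjacent \<Omega> a y"
      then have "a \<in> fst \<Omega>" by (auto simp: adjacent_def)
      then show False using a ne ns x y pt_on_ln[of a] by (auto simp: adjacent_iff)
    qed
    have "\<exists>a c. adjacent \<Omega> x a \<and> adjacent \<Omega> a c \<and> adjacent \<Omega> c y"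
      using t
    proof
      assume "third_line x y"
      then obtain n where n: "n \<in> Ln" "I (pt x) n" "I (pt y) n" "n \<noteq> ln x" "n \<noteq> ln y"
        by (auto simp: third_line_def)
      obtain a c where a: "a \<in> fst \<Omega>" "pt a = pt x" "ln a = n" and c: "c \<in> fst \<Omega>" "pt c = pt y" "ln c = n"
        using flag_ex n pt_in x y by metis
      have "adjacent \<Omega> x a" using a x n by (auto simp: adjacent_iff)
      moreover have "adjacent \<Omega> a c" using a c ne by (auto simp: adjacent_iff)
      moreover have "adjacent \<Omega> c y" using c y n by (auto simp: adjacent_iff)
      ultimately show ?thesis by blast
    next
      assume "third_point x y"
      then obtain n where n: "n \<in> Pt" "I n (ln x)" "I n (ln y)" "n \<noteq> pt x" "n \<noteq> pt y"
        by (auto simp: third_point_def)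
      obtain a c where a: "a \<in> fst \<Omega>" "ln a = ln x" "pt a = n" and c: "c \<in> fst \<Omega>" "ln c = ln y" "pt c = n"
        using flag_ex n ln_in x y by metis
      have "adjacent \<Omega> x a" using a x n by (auto simp: adjacent_iff)
      moreover have "adjacent \<Omega> a c" using a c ne by (auto simp: adjacent_iff)
      moreover have "adjacent \<Omega> c y" using c y n by (auto simp: adjacent_iff)
      ultimately show ?thesis by blast
    qed
    then show ?thesis using nadj n2 r by (auto simp: odd_rel_def dist3_iff)
  qed
qed

section \<open>Gate sets on the pencil of a point\<close>

lemma another_line:
  assumes A: "A \<in> Pt" and F: "finite F" "card F < k"
  obtains L where "L \<in> Ln" "I A L" "L \<notin> F"
  using ex_outside[OF F(1), of "{l \<in> Ln. I A l}"] F card_pencil[OF A] by auto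

lemma another_point:
  assumes K: "K \<in> Ln" and F: "finite F" "card F < k"
  obtains p where "p \<in> Pt" "I p K" "p \<notin> F"
  using ex_outside[OF F(1), of "{p \<in> Pt. I p K}"] F card_line[OF K] by auto

lemma card_two_less: "card {a, b} < k"
  using k_ge_3 card_insert_le_m1[of 2 "{b}" a] by simp

text \<open>These are the flags reached from m in two steps, first moving the point along
  \<open>ln m\<close>, then changing the line. Any other y at even distance from m has its nearest
  flag elsewhere in the pencil, at distance 1 or 3, and then has even distance to a third flag as
  well; a third flag exists since k is at least 3.\<close>

lemma gate_set_pencil:
  assumes A: "A \<in> Pt" and m: "m \<in> fst \<Omega>" "pt m = A"
  shows "gate_set \<Omega> {x \<in> fst \<Omega>. pt x = A} m =
    {y \<in> fst \<Omega>. I (pt y) (ln m) \<and> pt y \<noteq> A \<and> ln y \<noteq> ln m}" (is "?G = ?H")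
proof
  show "?H \<subseteq> ?G"
  proof
    fix y assume y: "y \<in> ?H"
    have yin: "y \<in> fst \<Omega>" using y by simp
    note f = pt_in[OF yin] ln_in[OF yin] pt_on_ln[OF yin] ln_in[OF m(1)] pt_on_ln[OF m(1)]
    have "\<not> third_line y m"
      using y join_unique[OF f(1) A _ f(4)] f m unfolding third_line_def by blast
    moreover have "\<not> third_point y m"
      using y join_unique[OF _ f(1) f(2) f(4)] f m unfolding third_point_def by blast
    ultimately have "\<not> odd_rel \<Omega> y m" using y m by (auto simp: odd_rel_iff)
    moreover have "odd_rel \<Omega> y n" if n: "n \<in> {x \<in> fst \<Omega>. pt x = A} - {m}" for n
    proof -
      have "ln n \<noteq> ln m" using n m flag_inj by auto
      then have "third_line y n" using y n m f A unfolding third_line_def by auto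
      then show ?thesis using y n by (auto simp: odd_rel_iff)
    qed
    ultimately show "y \<in> ?G" using y m by (auto simp: gate_set_def)
  qed
next
  show "?G \<subseteq> ?H"
  proof
    fix y assume y: "y \<in> ?G"
    have yin: "y \<in> fst \<Omega>" using y by (simp add: gate_set_def)
    have no: "\<not> odd_rel \<Omega> y m" "y \<noteq> m" using y by (auto simp: gate_set_def)
    have od: "odd_rel \<Omega> y n" if "n \<in> fst \<Omega>" "pt n = A" "n \<noteq> m" for n
      using y that by (auto simp: gate_set_def)
    have yA: "pt y \<noteq> A" using no od[of y] odd_rel_irrefl yin by metis
    have yl: "ln y \<noteq> ln m" using no yin m by (auto simp: odd_rel_iff)
    note f = pt_in[OF yin] ln_in[OF yin] pt_on_ln[OF yin] ln_in[OF m(1)] pt_on_ln[OF m(1)]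
    have "I (pt y) (ln m)"
    proof (rule ccontr)
      assume nI: "\<not> I (pt y) (ln m)"
      \<comment> \<open>Suppose K joins \<open>pt y\<close> to A. If K is \<open>ln y\<close>, then
        y is at distance 2 from a third flag (A, L). Otherwise K is a third line for y and m and
        makes them odd.\<close>
      have not_coll: "\<not> (I (pt y) K \<and> I A K)" if K: "K \<in> Ln" for K
      proof
        assume IK: "I (pt y) K \<and> I A K"
        show False
        proof (cases "ln y = K")
          case True
          obtain L where L: "L \<in> Ln" "I A L" "L \<noteq> K" "L \<noteq> ln m"
            using another_line[OF A _ card_two_less[of K "ln m"]] by auto
          obtain n where n: "n \<in> fst \<Omega>" "pt n = A" "ln n = L" using flag_ex A L by metis
          have "odd_rel \<Omega> y n" using od n L by auto
          then have "third_line y n \<or> third_point y n"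
            using odd_rel_iff[OF yin n(1)] n L True yA by auto
          then show False
            using no_short_path[OF yin n(1)] n L True yA IK by auto
        next
          case False
          have "K \<noteq> ln m" using IK nI by auto
          then have "third_line y m" using IK K m False unfolding third_line_def by auto
          then show False using no yin m by (auto simp: odd_rel_iff)
        qed
      qed
      \<comment> \<open>Now (A, l) is the flag of the pencil nearest to y. Any other line L through
        A misses \<open>ln y\<close>, since A has a unique projection to \<open>ln y\<close>; so (A,
        L) cannot be odd to y.\<close>
      obtain q l where ql: "q \<in> Pt" "l \<in> Ln" "I A l" "I q l" "I q (ln y)"
        using proj_ex[OF A f(2)] not_coll[OF f(2)] f by blast
      have qn: "q \<noteq> pt y" "q \<noteq> A" using ql f not_coll by auto
      have lm: "l \<noteq> ln m" using ql qn yin m no f unfolding odd_rel_iff[OF yin m(1)] third_point_def by auto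
      obtain L where L: "L \<in> Ln" "I A L" "L \<noteq> l" "L \<noteq> ln m"
            using another_line[OF A _ card_two_less[of l "ln m"]] by auto
      obtain n where n: "n \<in> fst \<Omega>" "pt n = A" "ln n = L" using flag_ex A L by metis
      have "odd_rel \<Omega> y n" using od n L by auto
      moreover have "\<not> third_line y n" using not_coll n unfolding third_line_def by auto
      moreover have "ln y \<noteq> ln n" using not_coll[OF f(2)] f L n by auto
      ultimately have "third_point y n" using odd_rel_iff[OF yin n(1)] n yA by auto
      then obtain r where "r \<in> Pt" "I r (ln y)" "I r L" using n by (auto simp: third_point_def)
      then show False
        using proj_unique[OF A f(2) _ ql(1,2,3,4,5), of r L] not_coll[OF f(2)] f L by blast
    qed
    then show "y \<in> ?H" using yin yA yl by simp
  qed
qed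


text \<open>Choose a point of \<open>ln m\<close> other than A, then a line through it other than
  \<open>ln m\<close>: there are k - 1 choices each time.\<close>

lemma card_gate_set_pencil:
  assumes A: "A \<in> Pt" and m: "m \<in> fst \<Omega>" "pt m = A"
  shows "card (gate_set \<Omega> {x \<in> fst \<Omega>. pt x = A} m) = (k - 1)\<^sup>2"
proof -
  let ?H = "{y \<in> fst \<Omega>. I (pt y) (ln m) \<and> pt y \<noteq> A \<and> ln y \<noteq> ln m}"
  let ?Q = "{p \<in> Pt. I p (ln m)} - {A}"
  let ?S = "Sigma ?Q (\<lambda>p. {l \<in> Ln. I p l} - {ln m})"
  have "bij_betw (\<lambda>y. (pt y, ln y)) ?H ?S"
  proof (rule bij_betw_imageI)
    show "inj_on (\<lambda>y. (pt y, ln y)) ?H" using flag_inj by (auto simp: inj_on_def)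
    show "(\<lambda>y. (pt y, ln y)) ` ?H = ?S"
    proof
      show "(\<lambda>y. (pt y, ln y)) ` ?H \<subseteq> ?S" using pt_in ln_in pt_on_ln by auto
      show "?S \<subseteq> (\<lambda>y. (pt y, ln y)) ` ?H"
      proof
        fix x assume x: "x \<in> ?S"
        then have "fst x \<in> Pt" "snd x \<in> Ln" "I (fst x) (snd x)" by auto
        then obtain y where "y \<in> fst \<Omega>" "pt y = fst x" "ln y = snd x"
          using flag_ex by blast
        with x show "x \<in> (\<lambda>y. (pt y, ln y)) ` ?H" by (auto intro!: image_eqI[of _ _ y])
      qed
    qed
  qed
  then have "card ?H = card ?S" by (rule bij_betw_same_card)
  also have "\<dots> = (\<Sum>p\<in>?Q. card ({l \<in> Ln. I p l} - {ln m}))"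
  proof (rule card_SigmaI)
    show "finite ?Q" using card_line[OF ln_in[OF m(1)]] k_ge_3
      by (metis card.infinite finite_Diff not_numeral_le_zero)
    show "\<forall>p\<in>?Q. finite ({l \<in> Ln. I p l} - {ln m})" using card_pencil k_ge_3
      by (metis (no_types, lifting) DiffD1 card.infinite finite_Diff mem_Collect_eq not_numeral_le_zero)
  qed
  also have "\<dots> = (\<Sum>p\<in>?Q. k - 1)"
    by (rule sum.cong) (use card_pencil ln_in[OF m(1)] in auto)
  also have "\<dots> = (k - 1) * (k - 1)"
    using card_line[OF ln_in[OF m(1)]] A m pt_on_ln[OF m(1)] by auto
  finally show ?thesis using gate_set_pencil[OF A m] by (simp add: power2_eq_square)
qed

text \<open>Adjacent members of the gate set share their point, for a shared line would have two
  points in common with \<open>ln m\<close>. So the neighbours of y are the flags on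
  \<open>pt y\<close> whose line is neither \<open>ln m\<close> nor \<open>ln y\<close>.\<close>

lemma gate_class_pencil:
  assumes A: "A \<in> Pt" and m: "m \<in> fst \<Omega>" "pt m = A"
    and y: "y \<in> gate_set \<Omega> {x \<in> fst \<Omega>. pt x = A} m"
  shows "card {y' \<in> gate_set \<Omega> {x \<in> fst \<Omega>. pt x = A} m. adjacent \<Omega> y' y} = k - 2"
proof -
  have y': "y \<in> fst \<Omega>" "I (pt y) (ln m)" "pt y \<noteq> A" "ln y \<noteq> ln m"
    using y unfolding gate_set_pencil[OF A m] by auto
  note f = pt_in[OF y'(1)] ln_in[OF y'(1)] pt_on_ln[OF y'(1)] ln_in[OF m(1)] pt_on_ln[OF m(1)]
  let ?C = "{y' \<in> gate_set \<Omega> {x \<in> fst \<Omega>. pt x = A} m. adjacent \<Omega> y' y}"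
  let ?D = "{z \<in> fst \<Omega>. pt z = pt y \<and> ln z \<noteq> ln m \<and> ln z \<noteq> ln y}"
  have eq: "?C = ?D"
  proof
    show "?C \<subseteq> ?D"
    proof
      fix z assume "z \<in> ?C"
      then have z: "z \<in> fst \<Omega>" "I (pt z) (ln m)" "pt z \<noteq> A" "ln z \<noteq> ln m" "adjacent \<Omega> z y"
        unfolding gate_set_pencil[OF A m] by auto
      have "pt z = pt y"
      proof (rule ccontr)
        assume "pt z \<noteq> pt y"
        moreover then have "ln z = ln y" using z y' by (auto simp: adjacent_iff)
        ultimately show False
          using join_unique[OF pt_in[OF z(1)] f(1) f(2) f(4)] z y' f pt_on_ln[OF z(1)] by auto
      qed
      moreover have "ln z \<noteq> ln y" using calculation z y' flag_inj by (auto simp: adjacent_iff)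
      ultimately show "z \<in> ?D" using z by simp
    qed
    show "?D \<subseteq> ?C" using y' unfolding gate_set_pencil[OF A m] by (auto simp: adjacent_iff)
  qed
  have "bij_betw ln ?D ({l \<in> Ln. I (pt y) l} - {ln m, ln y})"
  proof (rule bij_betw_imageI)
    show "inj_on ln ?D" using flag_inj by (auto simp: inj_on_def)
    show "ln ` ?D = {l \<in> Ln. I (pt y) l} - {ln m, ln y}"
    proof
      show "ln ` ?D \<subseteq> {l \<in> Ln. I (pt y) l} - {ln m, ln y}"
        using ln_in pt_on_ln by (auto) metis
      show "{l \<in> Ln. I (pt y) l} - {ln m, ln y} \<subseteq> ln ` ?D"
      proof
        fix l assume l: "l \<in> {l \<in> Ln. I (pt y) l} - {ln m, ln y}"
        then obtain z where "z \<in> fst \<Omega>" "pt z = pt y" "ln z = l" using flag_ex[of "pt y" l] f by auto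
        with l show "l \<in> ln ` ?D" by (auto intro!: image_eqI[of _ _ z])
      qed
    qed
  qed
  then have "card ?D = card ({l \<in> Ln. I (pt y) l} - {ln m, ln y})" by (rule bij_betw_same_card)
  also have "\<dots> = k - 2"
    using card_pencil[OF f(1)] f y' by (subst card_Diff_subset) auto
  finally show ?thesis using eq by simp
qed

text \<open>From y, the flag m is at distance 2 and every other flag of the pencil at distance
  3.\<close>

lemma gate_not_adjacent_pencil:
  assumes A: "A \<in> Pt" and m: "m \<in> fst \<Omega>" "pt m = A" and n: "n \<in> fst \<Omega>" "pt n = A"
    and y: "y \<in> gate_set \<Omega> {x \<in> fst \<Omega>. pt x = A} m"
  shows "\<not> adjacent \<Omega> n y"
proof -
  have y': "y \<in> fst \<Omega>" "I (pt y) (ln m)" "pt y \<noteq> A" "ln y \<noteq> ln m"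
    using y unfolding gate_set_pencil[OF A m] by auto
  note f = pt_in[OF y'(1)] ln_in[OF y'(1)] pt_on_ln[OF y'(1)] ln_in[OF m(1)] pt_on_ln[OF m(1)]
  have "ln n \<noteq> ln y" using join_unique[OF A f(1) f(2) f(4)] f y' m n pt_on_ln[OF n(1)] by auto
  then show ?thesis using y' n by (auto simp: adjacent_iff)
qed

text \<open>Otherwise y1 and y2 share a point p on \<open>ln m\<close>. As \<open>pt z\<close>
  projects to \<open>ln m\<close> at A, it is not collinear with p, so oddness makes
  \<open>ln z\<close> meet both \<open>ln y1\<close> and \<open>ln y2\<close>. Then p has two
  projections to \<open>ln z\<close>.\<close>

lemma gate_sets_pencil:
  assumes A: "A \<in> Pt" and m: "m \<in> fst \<Omega>" "pt m = A" and n: "n \<in> fst \<Omega>" "pt n = A" "n \<noteq> m"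
    and z: "z \<in> gate_set \<Omega> {x \<in> fst \<Omega>. pt x = A} n"
    and y1: "y1 \<in> gate_set \<Omega> {x \<in> fst \<Omega>. pt x = A} m"
    and y2: "y2 \<in> gate_set \<Omega> {x \<in> fst \<Omega>. pt x = A} m"
    and o: "odd_rel \<Omega> z y1" "odd_rel \<Omega> z y2"
  shows "\<not> adjacent \<Omega> y1 y2"
proof
  assume adj: "adjacent \<Omega> y1 y2"
  have y1': "y1 \<in> fst \<Omega>" "I (pt y1) (ln m)" "pt y1 \<noteq> A" "ln y1 \<noteq> ln m"
    using y1 unfolding gate_set_pencil[OF A m] by auto
  have y2': "y2 \<in> fst \<Omega>" "I (pt y2) (ln m)" "pt y2 \<noteq> A" "ln y2 \<noteq> ln m"
    using y2 unfolding gate_set_pencil[OF A m] by auto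
  have z': "z \<in> fst \<Omega>" "I (pt z) (ln n)" "pt z \<noteq> A" "ln z \<noteq> ln n"
    using z unfolding gate_set_pencil[OF A n(1,2)] by auto
  note f1 = pt_in[OF y1'(1)] ln_in[OF y1'(1)] pt_on_ln[OF y1'(1)]
  note f2 = pt_in[OF y2'(1)] ln_in[OF y2'(1)] pt_on_ln[OF y2'(1)]
  note fz = pt_in[OF z'(1)] ln_in[OF z'(1)] pt_on_ln[OF z'(1)]
  note fm = ln_in[OF m(1)] pt_on_ln[OF m(1)]
  note fn = ln_in[OF n(1)] pt_on_ln[OF n(1)]
  have mn: "ln m \<noteq> ln n" using flag_inj m n by auto
  have py: "pt y1 = pt y2"
  proof (rule ccontr)
    assume ne: "pt y1 \<noteq> pt y2"
    then have "ln y1 = ln y2" using adj y1' y2' by (auto simp: adjacent_iff)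
    then show False using join_unique[OF f1(1) f2(1) f1(2) fm(1)] ne y1' y2' f1 f2 by auto
  qed
  have ly: "ln y1 \<noteq> ln y2" using py adj y1' y2' flag_inj by (auto simp: adjacent_iff)
  have zm: "\<not> I (pt z) (ln m)"
    using join_unique[OF fz(1) A fm(1) fn(1)] z' fm fn m n mn by auto
  have nc: "\<not> (I (pt z) K \<and> I (pt y1) K)" if K: "K \<in> Ln" for K
    using proj_unique[OF fz(1) fm(1) zm A fn(1) z'(2) _ _ f1(1) K] fn fm m n y1' by auto
  have zy: "pt z \<noteq> pt y1" using zm y1' by auto
  have meet: "\<exists>r\<in>Pt. I r (ln z) \<and> I r (ln y)" if "odd_rel \<Omega> z y" "y \<in> fst \<Omega>" "pt y = pt y1" for y
  proof -
    have "\<not> third_line z y" using nc that unfolding third_line_def by auto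
    moreover have "ln z \<noteq> ln y" using nc[OF fz(2)] fz that pt_on_ln[of y] by metis
    ultimately have "third_point z y" using that odd_rel_iff[OF z'(1) that(2)] zy by auto
    then show ?thesis by (auto simp: third_point_def)
  qed
  obtain r1 where r1: "r1 \<in> Pt" "I r1 (ln z)" "I r1 (ln y1)" using meet[OF o(1) y1'(1)] by auto
  obtain r2 where r2: "r2 \<in> Pt" "I r2 (ln z)" "I r2 (ln y2)" using meet[OF o(2) y2'(1)] py by auto
  have "\<not> I (pt y1) (ln z)" using nc[OF fz(2)] fz by auto
  from proj_unique[OF f1(1) fz(2) this r1(1) f1(2) _ _ _ r2(1) f2(2)] r1 r2 f1 f2 py ly
  show False by auto
qed

text \<open>Take lines K and L through A and a further line J meeting K in Z. The flag z is (Z, J),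
  and y1, y2 arise by projecting two more points R1, R2 of J to L; they exist since k is at least
  3.\<close>

lemma configuration_exists:
  "\<exists>b\<in>snd \<Omega>. \<exists>i\<in>b. \<exists>m\<in>b. i \<noteq> m \<and> (\<exists>z\<in>gate_set \<Omega> b i. \<exists>y1\<in>gate_set \<Omega> b m. \<exists>y2\<in>gate_set \<Omega> b m.
     y1 \<noteq> y2 \<and> odd_rel \<Omega> z y1 \<and> odd_rel \<Omega> z y2)"
proof -
  obtain A where A: "A \<in> Pt" using Pt_nonempty by auto
  obtain K where K: "K \<in> Ln" "I A K" using another_line[OF A, of "{}"] k_ge_3 by auto
  obtain L where L: "L \<in> Ln" "I A L" "L \<noteq> K" using another_line[OF A, of "{K}"] k_ge_3 by auto
  obtain Z where Z: "Z \<in> Pt" "I Z K" "Z \<noteq> A" using another_point[OF K(1), of "{A}"] k_ge_3 by auto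
  obtain J where J: "J \<in> Ln" "I Z J" "J \<noteq> K" using another_line[OF Z(1), of "{K}"] k_ge_3 by auto
  obtain R1 where R1: "R1 \<in> Pt" "I R1 J" "R1 \<noteq> Z" using another_point[OF J(1), of "{Z}"] k_ge_3 by auto
  obtain R2 where R2: "R2 \<in> Pt" "I R2 J" "R2 \<noteq> Z" "R2 \<noteq> R1"
    using another_point[OF J(1) _ card_two_less[of Z R1]] by auto
  have ZL: "\<not> I Z L" using join_unique[OF Z(1) A K(1) L(1)] Z K L by auto
  \<comment> \<open>Z projects to L along K only, so J misses L.\<close>
  have JL: "\<not> (I r J \<and> I r L)" if "r \<in> Pt" for r
    using proj_unique[OF Z(1) L(1) ZL A K(1) Z(2) K(2) L(2) that J(1) J(2)] J by auto
  have AJ: "\<not> I A J" using JL[OF A] L by auto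
  obtain i where i: "i \<in> fst \<Omega>" "pt i = A" "ln i = K" using flag_ex[OF A K] by auto
  obtain m where m: "m \<in> fst \<Omega>" "pt m = A" "ln m = L" using flag_ex[OF A L(1,2)] by auto
  obtain z where z: "z \<in> fst \<Omega>" "pt z = Z" "ln z = J" using flag_ex[OF Z(1) J(1,2)] by auto
  let ?b = "{x \<in> fst \<Omega>. pt x = A}"
  have b: "?b \<in> snd \<Omega>" using A by (subst blocks) blast
  have zg: "z \<in> gate_set \<Omega> ?b i" unfolding gate_set_pencil[OF A i(1,2)] using z i Z J by auto
  have step: "\<exists>y\<in>gate_set \<Omega> ?b m. odd_rel \<Omega> z y \<and> I R (ln y)" if R: "R \<in> Pt" "I R J" "R \<noteq> Z" for R
  proof -
    have RL: "\<not> I R L" using JL R by auto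
    obtain Y N where Y: "Y \<in> Pt" "N \<in> Ln" "I R N" "I Y N" "I Y L" using proj_ex[OF R(1) L(1) RL] by auto
    obtain y where y: "y \<in> fst \<Omega>" "pt y = Y" "ln y = N" using flag_ex[OF Y(1,2,4)] by auto
    \<comment> \<open>If Y were A, both Z and R would be projections of A to J.\<close>
    have "Y \<noteq> A"
      using proj_unique[OF A J(1) AJ Z(1) K(1) K(2) Z(2) J(2) R(1) Y(2) _ Y(3) R(2)] Y R by auto
    moreover have "N \<noteq> L" using Y RL by auto
    ultimately have yg: "y \<in> gate_set \<Omega> ?b m"
      unfolding gate_set_pencil[OF A m(1,2)] using y m Y by auto
    have "third_point z y" unfolding third_point_def using R Y y z RL by auto
    moreover have "z \<noteq> y" using z y Y ZL by auto
    ultimately have "odd_rel \<Omega> z y" using odd_rel_iff[OF z(1) y(1)] by auto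
    then show ?thesis using yg y Y by auto
  qed
  obtain y1 where y1: "y1 \<in> gate_set \<Omega> ?b m" "odd_rel \<Omega> z y1" "I R1 (ln y1)" using step[OF R1] by auto
  obtain y2 where y2: "y2 \<in> gate_set \<Omega> ?b m" "odd_rel \<Omega> z y2" "I R2 (ln y2)" using step[OF R2(1-3)] by auto
  \<comment> \<open>If they were equal, their line would contain R1 and R2 and hence be J, which
    misses L.\<close>
  have "y1 \<noteq> y2"
  proof
    assume e: "y1 = y2"
    have y: "y1 \<in> fst \<Omega>" "I (pt y1) L" using y1 m unfolding gate_set_pencil[OF A m(1,2)] by auto
    then have "ln y1 = J" using join_unique[OF R1(1) R2(1) ln_in J(1)] y1 y2 e R1 R2 by auto
    then show False using JL[OF pt_in] y pt_on_ln[OF y(1)] by auto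
  qed
  moreover have "i \<noteq> m" using i m L by auto
  ultimately show ?thesis using b i m zg y1 y2
    by (intro bexI[OF _ b] bexI[of _ i] bexI[of _ m] conjI bexI[OF _ zg] bexI[OF _ y1(1)] bexI[OF _ y2(1)]) auto
qed

lemma card_pencil_block:
  assumes A: "A \<in> Pt"
  shows "card {x \<in> fst \<Omega>. pt x = A} = k"
proof -
  have "bij_betw ln {x \<in> fst \<Omega>. pt x = A} {l \<in> Ln. I A l}"
  proof (rule bij_betw_imageI)
    show "inj_on ln {x \<in> fst \<Omega>. pt x = A}" using flag_inj by (auto simp: inj_on_def)
    show "ln ` {x \<in> fst \<Omega>. pt x = A} = {l \<in> Ln. I A l}"
    proof
      show "ln ` {x \<in> fst \<Omega>. pt x = A} \<subseteq> {l \<in> Ln. I A l}" using ln_in pt_on_ln by blast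
      show "{l \<in> Ln. I A l} \<subseteq> ln ` {x \<in> fst \<Omega>. pt x = A}" using flag_ex[OF A] by blast
    qed
  qed
  from bij_betw_same_card[OF this] show ?thesis using card_pencil[OF A] by simp
qed

end

text \<open>The facts about an octagon of order q = k - 1 that the extension argument uses, phrased
  without flags so that both kinds of blocks are treated alike. The last clause expresses the
  absence of short circuits.\<close>

definition gated_line :: "nat \<Rightarrow> 'a incsys \<Rightarrow> 'a set \<Rightarrow> bool" where
  "gated_line k \<Omega> b \<longleftrightarrow> card b = k \<and>
     (\<forall>m\<in>b. card (gate_set \<Omega> b m) = (k - 1)\<^sup>2 \<and>
       (\<forall>y\<in>gate_set \<Omega> b m.
          card {y' \<in> gate_set \<Omega> b m. adjacent \<Omega> y' y} = k - 2 \<and>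
          (\<forall>n\<in>b. \<not> adjacent \<Omega> n y) \<and>
          (\<forall>y'\<in>gate_set \<Omega> b m. \<forall>n\<in>b - {m}. \<forall>z\<in>gate_set \<Omega> b n.
             odd_rel \<Omega> z y \<longrightarrow> odd_rel \<Omega> z y' \<longrightarrow> \<not> adjacent \<Omega> y y')))"

definition gated_octagon :: "nat \<Rightarrow> 'a incsys \<Rightarrow> bool" where
  "gated_octagon k \<Omega> \<longleftrightarrow> 3 \<le> k \<and> (\<forall>b\<in>snd \<Omega>. gated_line k \<Omega> b) \<and>
     (\<exists>b\<in>snd \<Omega>. \<exists>i\<in>b. \<exists>m\<in>b. i \<noteq> m \<and>
       (\<exists>z\<in>gate_set \<Omega> b i. \<exists>y1\<in>gate_set \<Omega> b m. \<exists>y2\<in>gate_set \<Omega> b m.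
          y1 \<noteq> y2 \<and> odd_rel \<Omega> z y1 \<and> odd_rel \<Omega> z y2))"

lemma (in flag_system) gated_line_pencil:
  assumes A: "A \<in> Pt"
  shows "gated_line k \<Omega> {x \<in> fst \<Omega>. pt x = A}"
  unfolding gated_line_def
proof (intro conjI ballI impI)
  show "card {x \<in> fst \<Omega>. pt x = A} = k" by (rule card_pencil_block[OF A])
  fix m assume "m \<in> {x \<in> fst \<Omega>. pt x = A}"
  then have m: "m \<in> fst \<Omega>" "pt m = A" by auto
  show "card (gate_set \<Omega> {x \<in> fst \<Omega>. pt x = A} m) = (k - 1)\<^sup>2"
    by (rule card_gate_set_pencil[OF A m])
  fix y assume y: "y \<in> gate_set \<Omega> {x \<in> fst \<Omega>. pt x = A} m"
  show "card {y' \<in> gate_set \<Omega> {x \<in> fst \<Omega>. pt x = A} m. adjacent \<Omega> y' y} = k - 2"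
    by (rule gate_class_pencil[OF A m y])
  show "\<not> adjacent \<Omega> n y" if "n \<in> {x \<in> fst \<Omega>. pt x = A}" for n
    using gate_not_adjacent_pencil[OF A m _ _ y] that by simp
  fix y' n z
  assume "y' \<in> gate_set \<Omega> {x \<in> fst \<Omega>. pt x = A} m" "n \<in> {x \<in> fst \<Omega>. pt x = A} - {m}"
    "z \<in> gate_set \<Omega> {x \<in> fst \<Omega>. pt x = A} n" "odd_rel \<Omega> z y" "odd_rel \<Omega> z y'"
  then show "\<not> adjacent \<Omega> y y'" using gate_sets_pencil[OF A m _ _ _ _ y] by blast
qed

text \<open>Every block is a pencil either of the flag system or of its dual.\<close>

lemma gated_octagon_flag_system:
  assumes "flag_system Pt Ln I k \<Omega> pt ln"
  shows "gated_octagon k \<Omega>"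
proof -
  interpret flag_system Pt Ln I k \<Omega> pt ln by fact
  interpret d: flag_system Ln Pt "\<lambda>l p. I p l" k \<Omega> ln pt by (rule flag_system_dual) fact
  have "gated_line k \<Omega> b" if "b \<in> snd \<Omega>" for b
    using that gated_line_pencil d.gated_line_pencil unfolding blocks by blast
  then show ?thesis
    unfolding gated_octagon_def using k_ge_3 configuration_exists by blast
qed

section \<open>Extended octagons\<close>

lemma fst_residue: "fst (residue \<Delta> n) = {x. adjacent \<Delta> n x}"
  by (auto simp: residue_def adjacent_def)

text \<open>The right-hand side is symmetric in n, x and y. A common block of three points can
  therefore be read in the residue of any of them.\<close>

lemma adjacent_residue_iff:
  assumes "incidence_system \<Delta>"
  shows "adjacent (residue \<Delta> n) x y \<longleftrightarrow>
    n \<noteq> x \<and> n \<noteq> y \<and> x \<noteq> y \<and> (\<exists>b\<in>snd \<Delta>. n \<in> b \<and> x \<in> b \<and> y \<in> b)"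
    (is "?l \<longleftrightarrow> ?r")
proof
  assume ?l
  then obtain c where "c \<in> snd (residue \<Delta> n)" "x \<in> c" "y \<in> c" "x \<noteq> y"
    unfolding adjacent_def by blast
  then show ?r unfolding residue_def by auto
next
  assume r: ?r
  then obtain b where b: "b \<in> snd \<Delta>" "n \<in> b" "x \<in> b" "y \<in> b" by blast
  then have bn: "b - {n} \<in> snd (residue \<Delta> n)" by (auto simp: residue_def)
  have "b \<subseteq> fst \<Delta>" using assms b by (auto simp: incidence_system_def)
  then have "adjacent \<Delta> n x" "adjacent \<Delta> n y" using r b unfolding adjacent_def by blast+
  then have "x \<in> fst (residue \<Delta> n)" "y \<in> fst (residue \<Delta> n)" by (simp_all add: fst_residue)
  moreover have "\<exists>c\<in>snd (residue \<Delta> n). x \<in> c \<and> y \<in> c"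
    by (rule bexI[OF _ bn]) (use r b in auto)
  moreover have "x \<noteq> y" using r by simp
  ultimately show ?l unfolding adjacent_def[of "residue \<Delta> n"] by (intro conjI)
qed

text \<open>For distinct x and y in a common block with n both sides hold. For any other triple of
  distinct points, x and y are not collinear in the residue, and the triangle condition matches
  adjacency with distance 3.\<close>

lemma adjacent_iff_odd_rel_residue:
  assumes inc: "incidence_system \<Delta>" and tri: "triangle_cond \<Delta>"
    and x: "adjacent \<Delta> n x" and y: "adjacent \<Delta> n y"
  shows "adjacent \<Delta> x y \<longleftrightarrow> odd_rel (residue \<Delta> n) x y"
proof (cases "x = y")
  case True
  then show ?thesis by (auto simp: odd_rel_irrefl adjacent_def)
next
  case False
  have in': "n \<in> fst \<Delta>" "x \<in> fst \<Delta>" "y \<in> fst \<Delta>" "n \<noteq> x" "n \<noteq> y"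
    using x y by (auto simp: adjacent_def)
  show ?thesis
  proof (cases "\<exists>b\<in>snd \<Delta>. {n, x, y} \<subseteq> b")
    case True
    then have "adjacent (residue \<Delta> n) x y" "adjacent \<Delta> x y"
      using False in' unfolding adjacent_residue_iff[OF inc] by (auto simp: adjacent_def)
    then show ?thesis by (auto simp: odd_rel_def)
  next
    case nb: False
    then have "\<not> adjacent (residue \<Delta> n) x y" unfolding adjacent_residue_iff[OF inc] by blast
    moreover have "(adjacent \<Delta> n x \<and> adjacent \<Delta> n y \<and> adjacent \<Delta> x y) \<longleftrightarrow>
        (x \<in> fst (residue \<Delta> n) \<and> y \<in> fst (residue \<Delta> n) \<and> dist3 (residue \<Delta> n) x y)"
      using tri[unfolded triangle_cond_def] in' False nb by blast
    ultimately show ?thesis using x y by (auto simp: odd_rel_def fst_residue)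
  qed
qed

section \<open>The plane of order k - 1 attached to a block and one of its points\<close>

locale extended_octagon =
  fixes \<Delta> :: "'a incsys" and k :: nat
  assumes inc: "incidence_system \<Delta>"
    and tri: "triangle_cond \<Delta>"
    and oct: "n \<in> fst \<Delta> \<Longrightarrow> gated_octagon k (residue \<Delta> n)"
begin

definition block_gate_set :: "'a set \<Rightarrow> 'a \<Rightarrow> 'a set" where
  "block_gate_set B m = {y. y \<noteq> m \<and> \<not> adjacent \<Delta> y m \<and> (\<forall>n\<in>B - {m}. adjacent \<Delta> y n)}"

lemma block_adjacent:
  assumes "B \<in> snd \<Delta>" "m \<in> B" "n \<in> B" "m \<noteq> n"
  shows "adjacent \<Delta> m n"
  using assms inc by (auto simp: adjacent_def incidence_system_def)

text \<open>Oddness in the residue of n is adjacency in \<open>\<Delta>\<close>, so all n in B - {m}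
  see the same gate set. This allows the views from different n to be compared.\<close>

lemma gate_set_residue:
  assumes B: "B \<in> snd \<Delta>" and m: "m \<in> B" and n: "n \<in> B" "n \<noteq> m"
  shows "gate_set (residue \<Delta> n) (B - {n}) m = block_gate_set B m"
proof -
  have odd: "odd_rel (residue \<Delta> n) y x \<longleftrightarrow> adjacent \<Delta> y x" if "adjacent \<Delta> n y" "x \<in> B" "x \<noteq> n" for x y
    using adjacent_iff_odd_rel_residue[OF inc tri that(1)] block_adjacent[OF B n(1) that(2)] that by auto
  have sym: "adjacent \<Delta> n y \<longleftrightarrow> adjacent \<Delta> y n" for y by (rule adjacent_sym)
  show ?thesis
  proof (rule set_eqI)
    fix y
    show "y \<in> gate_set (residue \<Delta> n) (B - {n}) m \<longleftrightarrow> y \<in> block_gate_set B m"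
    proof (cases "adjacent \<Delta> n y")
      case True
      then have "(\<forall>x\<in>B - {n} - {m}. odd_rel (residue \<Delta> n) y x) \<longleftrightarrow> (\<forall>x\<in>B - {m}. adjacent \<Delta> y x)"
        using odd sym by blast
      then show ?thesis using odd[OF True m] n True
        by (auto simp: gate_set_def fst_residue block_gate_set_def)
    next
      case False
      then show ?thesis using sym n by (auto simp: gate_set_def fst_residue block_gate_set_def)
    qed
  qed
qed

lemma residue_block:
  assumes "B \<in> snd \<Delta>" "n \<in> B"
  shows "B - {n} \<in> snd (residue \<Delta> n)"
  using assms by (auto simp: residue_def)

lemma gated:
  assumes B: "B \<in> snd \<Delta>" and n: "n \<in> B"
  shows "3 \<le> k" "gated_line k (residue \<Delta> n) (B - {n})"
  using oct[of n] residue_block[OF assms] inc assms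
  unfolding gated_octagon_def incidence_system_def by auto

text \<open>Each of the k points n of B - {m} joins y1 to k - 2 further points of the gate set, and
  different n give disjoint sets. Together these are k (k - 2) = (k - 1)^2 - 1 points, which is all
  of the gate set except y1.\<close>

lemma gate_pair_joined:
  assumes B: "B \<in> snd \<Delta>" and m: "m \<in> B"
    and y1: "y1 \<in> block_gate_set B m" and y2: "y2 \<in> block_gate_set B m" and ne: "y1 \<noteq> y2"
  obtains n where "n \<in> B - {m}" "adjacent (residue \<Delta> n) y2 y1"
proof -
  let ?Y = "block_gate_set B m"
  define S where "S n = {y \<in> ?Y. adjacent (residue \<Delta> n) y y1}" for n
  have finB: "finite B" using inc B by (auto simp: incidence_system_def)
  have k3: "3 \<le> k" using gated[OF B m] by simp
  \<comment> \<open>B - {m} is a line in the residue of m.\<close>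
  have cardB: "card (B - {m}) = k" using gated[OF B m] by (simp add: gated_line_def)
  then obtain n0 where n0: "n0 \<in> B" "n0 \<noteq> m" using k3 ex_outside[of "{}" "B - {m}"] by auto
  have G: "gated_line k (residue \<Delta> n) (B - {n})" if "n \<in> B" for n using gated[OF B that] by simp
  have "card (gate_set (residue \<Delta> n0) (B - {n0}) m) = (k - 1)\<^sup>2"
    using G[OF n0(1)] m n0 by (auto simp: gated_line_def)
  then have cardY: "card ?Y = (k - 1)\<^sup>2" using gate_set_residue[OF B m n0] by simp
  then have finY: "finite ?Y" using k3 card.infinite by fastforce
  have cardS: "card (S n) = k - 2" if n: "n \<in> B - {m}" for n
  proof -
    have e: "gate_set (residue \<Delta> n) (B - {n}) m = ?Y" using gate_set_residue[OF B m] n by auto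
    have "m \<in> B - {n}" "n \<in> B" using m n by auto
    then have "\<forall>y\<in>gate_set (residue \<Delta> n) (B - {n}) m.
        card {y' \<in> gate_set (residue \<Delta> n) (B - {n}) m. adjacent (residue \<Delta> n) y' y} = k - 2"
      using G[of n] unfolding gated_line_def by blast
    then show ?thesis using y1 unfolding S_def e by blast
  qed
  have notadj: "\<not> adjacent (residue \<Delta> n) n' y" if "n \<in> B - {m}" "n' \<in> B - {n}" "y \<in> ?Y" for n n' y
  proof -
    have e: "gate_set (residue \<Delta> n) (B - {n}) m = ?Y" using gate_set_residue[OF B m] that by auto
    have "m \<in> B - {n}" using m that by auto
    with G[of n] that e show ?thesis unfolding gated_line_def by blast
  qed
  \<comment> \<open>Suppose y lies in both sets. In the residue of y1 it is a common neighbour of n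
    and n', which are odd there because they are adjacent. So n, n', y1 share a block, and in the
    residue of n the point y1 is collinear with n' on the line B - {n}, against
    \<open>notadj\<close>.\<close>
  have disj: "S n \<inter> S n' = {}" if n: "n \<in> B - {m}" and n': "n' \<in> B - {m}" and nn: "n \<noteq> n'" for n n'
  proof (rule ccontr)
    assume "S n \<inter> S n' \<noteq> {}"
    then obtain y where y: "y \<in> ?Y" "adjacent (residue \<Delta> n) y y1" "adjacent (residue \<Delta> n') y y1"
      unfolding S_def by auto
    then have "adjacent (residue \<Delta> y1) n y" "adjacent (residue \<Delta> y1) y n'"
      unfolding adjacent_residue_iff[OF inc] by auto
    moreover have "odd_rel (residue \<Delta> y1) n n'"
      using adjacent_iff_odd_rel_residue[OF inc tri, of y1 n n'] y1 n n' nn block_adjacent[OF B, of n n']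
      by (auto simp: block_gate_set_def)
    ultimately have "adjacent (residue \<Delta> y1) n n'" using odd_rel_common_neighbour by metis
    then have "adjacent (residue \<Delta> n) n' y1" unfolding adjacent_residue_iff[OF inc] by auto
    then show False using notadj[of n n' y1] n n' nn y1 by auto
  qed
  have "card (\<Union>n\<in>B - {m}. S n) = (\<Sum>n\<in>B - {m}. card (S n))"
    by (rule card_UN_disjoint) (use finB finY disj in \<open>auto simp: S_def\<close>)
  also have "\<dots> = k * (k - 2)" using cardS cardB by simp
  finally have c: "card (\<Union>n\<in>B - {m}. S n) = k * (k - 2)" .
  have sub: "(\<Union>n\<in>B - {m}. S n) \<subseteq> ?Y - {y1}" unfolding S_def by (auto simp: adjacent_def)
  have "card (?Y - {y1}) = (k - 1)\<^sup>2 - 1" using cardY y1 by simp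
  also have "\<dots> = k * (k - 2)"
  proof -
    \<comment> \<open>Writing k as j + 3 removes the truncated subtractions.\<close>
    obtain j where "k = j + 3" using le_Suc_ex[OF k3] add.commute by metis
    then show ?thesis by (simp add: power2_eq_square algebra_simps)
  qed
  finally have "(\<Union>n\<in>B - {m}. S n) = ?Y - {y1}" using card_subset_eq[OF _ sub] finY c by simp
  then obtain n where "n \<in> B - {m}" "y2 \<in> S n" using y2 ne by blast
  then show ?thesis using that by (auto simp: S_def)
qed

text \<open>Some n of the block joins y1 and y2. If n were not i, then also in the residue of n the
  points y1, y2 would have gate m, z would have gate i, and z would be odd to both; the last clause
  of \<open>gated_line\<close> excludes this. The excluded cases include n = v.\<close>

lemma configuration_joined:
  assumes b: "b \<in> snd (residue \<Delta> v)" and i: "i \<in> b" and m: "m \<in> b" and im: "i \<noteq> m"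
    and z: "z \<in> gate_set (residue \<Delta> v) b i"
    and y1: "y1 \<in> gate_set (residue \<Delta> v) b m" and y2: "y2 \<in> gate_set (residue \<Delta> v) b m"
    and ne: "y1 \<noteq> y2"
    and o: "odd_rel (residue \<Delta> v) z y1" "odd_rel (residue \<Delta> v) z y2"
  shows "adjacent (residue \<Delta> i) y1 y2"
proof -
  obtain B where B: "B \<in> snd \<Delta>" "v \<in> B" "b = B - {v}" using b by (auto simp: residue_def)
  have iB: "i \<in> B" "v \<noteq> i" and mB: "m \<in> B" "v \<noteq> m" using i m B by auto
  have zg: "z \<in> block_gate_set B i" using gate_set_residue[OF B(1) iB(1) B(2) iB(2)] z B by simp
  have y1g: "y1 \<in> block_gate_set B m" using gate_set_residue[OF B(1) mB(1) B(2) mB(2)] y1 B by simp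
  have y2g: "y2 \<in> block_gate_set B m" using gate_set_residue[OF B(1) mB(1) B(2) mB(2)] y2 B by simp
  have v: "adjacent \<Delta> v z" "adjacent \<Delta> v y1" "adjacent \<Delta> v y2"
    using z y1 y2 by (auto simp: gate_set_def fst_residue)
  \<comment> \<open>Adjacency in \<open>\<Delta>\<close> carries the oddness from the residue of v
    to that of n.\<close>
  have zy: "adjacent \<Delta> z y1" "adjacent \<Delta> z y2"
    using o adjacent_iff_odd_rel_residue[OF inc tri] v by blast+
  obtain n where n: "n \<in> B - {m}" "adjacent (residue \<Delta> n) y2 y1"
    using gate_pair_joined[OF B(1) mB(1) y1g y2g ne] by auto
  have "n = i"
  proof (rule ccontr)
    assume ni: "n \<noteq> i"
    have nB: "n \<in> B" "n \<noteq> m" using n by auto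
    have z': "z \<in> gate_set (residue \<Delta> n) (B - {n}) i" using gate_set_residue[OF B(1) iB(1) nB(1) ni] zg by simp
    have y': "y1 \<in> gate_set (residue \<Delta> n) (B - {n}) m" "y2 \<in> gate_set (residue \<Delta> n) (B - {n}) m"
      using gate_set_residue[OF B(1) mB(1) nB] y1g y2g by auto
    have "adjacent \<Delta> n z" "adjacent \<Delta> n y1" "adjacent \<Delta> n y2"
      using z' y' by (auto simp: gate_set_def fst_residue)
    then have "odd_rel (residue \<Delta> n) z y1" "odd_rel (residue \<Delta> n) z y2"
      using zy adjacent_iff_odd_rel_residue[OF inc tri] by blast+
    moreover have "m \<in> B - {n}" "i \<in> B - {n} - {m}" using mB iB ni nB im by auto
    ultimately have "\<not> adjacent (residue \<Delta> n) y2 y1"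
      using gated(2)[OF B(1) nB(1)] z' y' unfolding gated_line_def by blast
    then show False using n by simp
  qed
  then show ?thesis using n adjacent_sym by metis
qed

end

section \<open>Comparing the residues of three points in an extension\<close>

lemma residue_residue_commute:
  assumes "incidence_system \<Gamma>"
  shows "residue (residue \<Gamma> u) v = residue (residue \<Gamma> v) u"
proof (rule prod_eqI)
  show "fst (residue (residue \<Gamma> u) v) = fst (residue (residue \<Gamma> v) u)"
    unfolding fst_residue adjacent_residue_iff[OF assms] by auto
  have *: "snd (residue (residue \<Gamma> u) v) \<subseteq> snd (residue (residue \<Gamma> v) u)" for u v
  proof
    fix c assume "c \<in> snd (residue (residue \<Gamma> u) v)"
    then obtain b where b: "b \<in> snd \<Gamma>" "u \<in> b" "v \<in> b" "v \<noteq> u" "c = b - {u} - {v}"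
      by (auto simp: residue_def)
    then have "b - {v} \<in> snd (residue \<Gamma> v)" "u \<in> b - {v}" "c = b - {v} - {u}"
      by (auto simp: residue_def)
    then show "c \<in> snd (residue (residue \<Gamma> v) u)"
      unfolding residue_def[of "residue \<Gamma> v"] by auto
  qed
  show "snd (residue (residue \<Gamma> u) v) = snd (residue (residue \<Gamma> v) u)"
    using * by blast
qed

text \<open>The residues of u, v and i may be of different kinds, so each carries its own parameter.
  The octagon of the pair u, v belongs to the residues of both, hence one configuration in it can be
  used twice.\<close>

theorem no_extension_of_extended_octagons:
  assumes inc: "incidence_system \<Gamma>" and ne: "fst \<Gamma> \<noteq> {}"
    and ext: "\<And>u. u \<in> fst \<Gamma> \<Longrightarrow> fst (residue \<Gamma> u) \<noteq> {} \<and> (\<exists>k. extended_octagon (residue \<Gamma> u) k)"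
  shows False
proof -
  obtain u where u: "u \<in> fst \<Gamma>" using ne by auto
  obtain k v where k: "extended_octagon (residue \<Gamma> u) k" and v: "v \<in> fst (residue \<Gamma> u)" using ext[OF u] by auto
  have uv: "adjacent \<Gamma> u v" using v by (simp add: fst_residue)
  then have v': "v \<in> fst \<Gamma>" by (auto simp: adjacent_def)
  then obtain k' where k': "extended_octagon (residue \<Gamma> v) k'" using ext by auto
  interpret U: extended_octagon "residue \<Gamma> u" k by fact
  interpret V: extended_octagon "residue \<Gamma> v" k' by fact
  let ?\<Omega> = "residue (residue \<Gamma> u) v"
  have comm: "residue (residue \<Gamma> v) u = ?\<Omega>" using residue_residue_commute[OF inc] by metis
  have oct: "gated_octagon k ?\<Omega>" using U.oct[OF v] .
  then obtain b i m z y1 y2 where b: "b \<in> snd ?\<Omega>" and im: "i \<in> b" "m \<in> b" "i \<noteq> m"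
    and z: "z \<in> gate_set ?\<Omega> b i" and y: "y1 \<in> gate_set ?\<Omega> b m" "y2 \<in> gate_set ?\<Omega> b m" "y1 \<noteq> y2"
    and o: "odd_rel ?\<Omega> z y1" "odd_rel ?\<Omega> z y2"
    unfolding gated_octagon_def by blast
  have Ui: "adjacent (residue (residue \<Gamma> u) i) y1 y2"
    using U.configuration_joined[OF b im z y o] .
  have Vi: "adjacent (residue (residue \<Gamma> v) i) y1 y2"
    using V.configuration_joined[of b u i m z y1 y2] b im z y o unfolding comm by simp
  \<comment> \<open>The gate of y1 on the line b is m, at distance 2, so y1 is collinear with no
    point of b.\<close>
  have nadj: "\<not> adjacent ?\<Omega> i y1"
    using oct b im y unfolding gated_octagon_def gated_line_def by blast
  have "i \<in> fst (residue \<Gamma> u)" "i \<in> fst (residue \<Gamma> v)"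
    using Ui Vi unfolding adjacent_residue_iff[OF U.inc] adjacent_residue_iff[OF V.inc]
    using U.inc V.inc unfolding incidence_system_def by blast+
  then have ui: "adjacent \<Gamma> u i" and vi: "adjacent \<Gamma> v i" by (auto simp: fst_residue)
  then have i': "i \<in> fst \<Gamma>" by (auto simp: adjacent_def)
  then obtain l where "extended_octagon (residue \<Gamma> i) l" using ext by auto
  then interpret E: extended_octagon "residue \<Gamma> i" l .
  have block: "\<exists>c\<in>snd \<Gamma>. w \<in> c \<and> i \<in> c \<and> y1 \<in> c \<and> y2 \<in> c \<and> w \<noteq> y1 \<and> w \<noteq> y2 \<and> w \<noteq> i \<and> i \<noteq> y1 \<and> i \<noteq> y2 \<and> y1 \<noteq> y2"
    if "adjacent (residue (residue \<Gamma> w) i) y1 y2" "incidence_system (residue \<Gamma> w)" for w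
    using that(1) unfolding adjacent_residue_iff[OF that(2)] by (auto simp: residue_def)
  \<comment> \<open>The block through u, i, y1, y2 is read in the residue of i and then of y1, where
    it makes y2 a neighbour of u; likewise for v.\<close>
  have y1u: "adjacent (residue (residue \<Gamma> i) y1) y2 u" "adjacent (residue (residue \<Gamma> i) y1) y2 v"
    using block[OF Ui U.inc] block[OF Vi V.inc] unfolding adjacent_residue_iff[OF E.inc]
    by (auto simp: residue_def)
  have "i \<in> fst ?\<Omega>" using im b U.inc unfolding residue_def
    by (auto simp: incidence_system_def adjacent_def)
  \<comment> \<open>Since i is a point of the octagon of u, v, these three points share a block.
    Adjacency of u and v in the residue of i then becomes oddness in the residue of y1.\<close>
  then have "adjacent (residue \<Gamma> i) u v"
    unfolding fst_residue adjacent_residue_iff[OF inc] using uv by (auto simp: adjacent_def)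
  then have "odd_rel (residue (residue \<Gamma> i) y1) u v"
    using adjacent_iff_odd_rel_residue[OF E.inc E.tri, of y1 u v] y1u
    by (auto simp: adjacent_def[of "residue (residue \<Gamma> i) y1"] fst_residue)
  then have "adjacent (residue (residue \<Gamma> i) y1) u v"
    using odd_rel_common_neighbour y1u adjacent_sym by metis
  \<comment> \<open>The common block of u, v, i, y1 is read again in the octagon of u, v.\<close>
  then have "adjacent ?\<Omega> i y1"
    unfolding adjacent_residue_iff[OF E.inc] adjacent_residue_iff[OF U.inc] by (auto simp: residue_def)
  then show False using nadj by simp
qed

section \<open>The symplectic quadrangle\<close>

abbreviation vplus :: "('k::field) vec4 \<Rightarrow> 'k vec4 \<Rightarrow> 'k vec4" where "vplus \<equiv> vadd (+)"
abbreviation vscale :: "('k::field) \<Rightarrow> 'k vec4 \<Rightarrow> 'k vec4" where "vscale \<equiv> smul (*)"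
abbreviation vzero :: "('k::field) vec4" where "vzero \<equiv> (0, 0, 0, 0)"
abbreviation form :: "('k::field) vec4 \<Rightarrow> 'k vec4 \<Rightarrow> 'k" where "form \<equiv> symp (+) uminus (*)"
abbreviation ray :: "('k::field) vec4 \<Rightarrow> 'k vec4 set" where "ray \<equiv> span1 (*)"
abbreviation plane :: "('k::field) vec4 \<Rightarrow> 'k vec4 \<Rightarrow> 'k vec4 set" where "plane \<equiv> span2 (+) (*)"

lemma form_vplus_left: "form (vplus a b) c = form a c + form b c"
  by (cases a; cases b; cases c) (simp add: algebra_simps)

lemma form_vplus_right: "form c (vplus a b) = form c a + form c b"
  by (cases a; cases b; cases c) (simp add: algebra_simps)

lemma form_vscale_left: "form (vscale x a) c = x * form a c"
  by (cases a; cases c) (simp add: algebra_simps)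

lemma form_vscale_right: "form c (vscale x a) = x * form c a"
  by (cases a; cases c) (simp add: algebra_simps)

lemma form_self: "form a a = 0"
  by (cases a) (simp add: algebra_simps)

lemma form_swap: "form b a = - form a b"
  by (cases a; cases b) (simp add: algebra_simps)

lemmas form_simps = form_vplus_left form_vplus_right form_vscale_left form_vscale_right form_self

lemma vec_comb: "vplus (vscale x (vplus (vscale a v) (vscale b w))) (vscale y (vplus (vscale c v) (vscale d w)))
   = vplus (vscale (x * a + y * c) v) (vscale (x * b + y * d) w)"
  by (cases v; cases w) (simp add: algebra_simps)

lemma vscale_vplus: "vscale x (vplus a b) = vplus (vscale x a) (vscale x b)"
  by (cases a; cases b) (simp add: algebra_simps)

lemma vscale_vscale: "vscale x (vscale y a) = vscale (x * y) a"
  by (cases a) (simp add: algebra_simps)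

lemma vscale_one [simp]: "vscale 1 a = a"
  by (cases a) simp

lemma vscale_zero [simp]: "vscale 0 a = vzero"
  by (cases a) simp

lemma vplus_vzero [simp]: "vplus a vzero = a" "vplus vzero a = a"
  by (cases a, simp)+

lemma vscale_eq_vzero: "vscale x a = vzero \<longleftrightarrow> x = 0 \<or> a = vzero"
  by (cases a) auto

lemma plane_iff: "a \<in> plane v w \<longleftrightarrow> (\<exists>x y. a = vplus (vscale x v) (vscale y w))"
  by (auto simp: span2_def)

lemma ray_iff: "a \<in> ray v \<longleftrightarrow> (\<exists>x. a = vscale x v)"
  by (auto simp: span1_def)

lemma self_in_ray: "a \<in> ray a"
  unfolding ray_iff by (rule exI[of _ 1]) simp

lemma ray_eq:
  assumes "b \<in> ray a" "b \<noteq> vzero"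
  shows "ray b = ray a"
proof -
  obtain x where b: "b = vscale x a" using assms(1) by (auto simp: ray_iff)
  then have "x \<noteq> 0" using assms(2) by auto
  then have "a = vscale (1 / x) b" by (simp add: b vscale_vscale)
  then show ?thesis unfolding ray_iff set_eq_iff using b vscale_vscale by metis
qed

lemma ray_subset_plane: "ray a \<subseteq> plane v w \<longleftrightarrow> a \<in> plane v w"
proof
  assume "a \<in> plane v w"
  then obtain x y where a: "a = vplus (vscale x v) (vscale y w)" by (auto simp: plane_iff)
  have "vscale z a = vplus (vscale (z * x) v) (vscale (z * y) w)" for z
    by (simp add: a vscale_vplus vscale_vscale)
  then show "ray a \<subseteq> plane v w" unfolding plane_iff ray_iff subset_iff by metis
qed (use self_in_ray in blast)

lemma gens_in_plane: "v \<in> plane v w" "w \<in> plane v w"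
  unfolding plane_iff by (rule exI[of _ 1], rule exI[of _ 0], simp, rule exI[of _ 0], rule exI[of _ 1], simp)

text \<open>Independence of a and b makes the determinant of their coefficients nonzero, and
  Cramer's rule expresses every vector of the plane through a and b.\<close>

lemma plane_exchange:
  assumes a: "a \<in> plane v w" and b: "b \<in> plane v w" and a0: "a \<noteq> vzero" and ba: "b \<notin> ray a"
  shows "plane v w = plane a b"
proof -
  obtain p q where ap: "a = vplus (vscale p v) (vscale q w)" using a by (auto simp: plane_iff)
  obtain r s where br: "b = vplus (vscale r v) (vscale s w)" using b by (auto simp: plane_iff)
  have det: "p * s - q * r \<noteq> 0"
  proof
    assume d: "p * s - q * r = 0"
    have "p \<noteq> 0 \<or> q \<noteq> 0" using a0 ap by auto
    then have "\<exists>t. r = t * p \<and> s = t * q"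
    proof
      assume "p \<noteq> 0" then show ?thesis using d by (intro exI[of _ "r / p"]) (simp add: field_simps)
    next
      assume "q \<noteq> 0" then show ?thesis using d by (intro exI[of _ "s / q"]) (simp add: field_simps)
    qed
    then obtain t where "b = vscale t a" by (auto simp: ap br vscale_vplus vscale_vscale)
    then show False using ba by (auto simp: ray_iff)
  qed
  show ?thesis
  proof
    show "plane a b \<subseteq> plane v w"
      unfolding ap br plane_iff subset_iff using vec_comb by metis
    show "plane v w \<subseteq> plane a b"
    proof
      fix c assume "c \<in> plane v w"
      then obtain x y where c: "c = vplus (vscale x v) (vscale y w)" by (auto simp: plane_iff)
      let ?d = "p * s - q * r"
      have "((x * s - y * r) / ?d) * p + ((y * p - x * q) / ?d) * r = x"
           "((x * s - y * r) / ?d) * q + ((y * p - x * q) / ?d) * s = y"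
        using det by (simp_all add: divide_simps) (simp_all add: algebra_simps)
      then have "c = vplus (vscale ((x * s - y * r) / ?d) a) (vscale ((y * p - x * q) / ?d) b)"
        unfolding ap br vec_comb c by simp
      then show "c \<in> plane a b" unfolding plane_iff by blast
    qed
  qed
qed

text \<open>A totally isotropic plane is its own orthogonal complement: the three relations make all
  3 by 3 minors of v, w, a vanish, while some 2 by 2 minor of v, w does not.\<close>

lemma perp_subset_plane:
  assumes v0: "v \<noteq> vzero" and wv: "w \<notin> ray v"
    and o: "form v w = 0" "form a v = 0" "form a w = 0"
  shows "a \<in> plane v w"
proof -
  obtain v1 v2 v3 v4 where v: "v = (v1, v2, v3, v4)" by (cases v)
  obtain w1 w2 w3 w4 where w: "w = (w1, w2, w3, w4)" by (cases w)
  obtain a1 a2 a3 a4 where a: "a = (a1, a2, a3, a4)" by (cases a)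
  have o1: "v1 * w2 - v2 * w1 + (v3 * w4 - v4 * w3) = 0"
    and o2: "a1 * v2 - a2 * v1 + (a3 * v4 - a4 * v3) = 0"
    and o3: "a1 * w2 - a2 * w1 + (a3 * w4 - a4 * w3) = 0"
    using o by (simp_all add: v w a)
  \<comment> \<open>The minors of the matrix with rows v, w, a are, up to sign, the coordinates of the vector
    form(v, w) a + form(w, a) v + form(a, v) w.\<close>
  have m: "v1 * (w2 * a3 - w3 * a2) - v2 * (w1 * a3 - w3 * a1) + v3 * (w1 * a2 - w2 * a1) = 0"
    "v1 * (w2 * a4 - w4 * a2) - v2 * (w1 * a4 - w4 * a1) + v4 * (w1 * a2 - w2 * a1) = 0"
    "v1 * (w3 * a4 - w4 * a3) - v3 * (w1 * a4 - w4 * a1) + v4 * (w1 * a3 - w3 * a1) = 0"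
    "v2 * (w3 * a4 - w4 * a3) - v3 * (w2 * a4 - w4 * a2) + v4 * (w2 * a3 - w3 * a2) = 0"
    using o1 o2 o3 by algebra+
  \<comment> \<open>Here d will be a nonzero 2 by 2 minor of v and w, and x, y are the same minor
    with v, respectively w, replaced by a.\<close>
  have cramer: "a \<in> plane v w" if d: "d \<noteq> 0"
    and "a1 * d = x * v1 + y * w1" "a2 * d = x * v2 + y * w2" "a3 * d = x * v3 + y * w3" "a4 * d = x * v4 + y * w4"
    for d x y
    unfolding plane_iff
    by (rule exI[of _ "x / d"], rule exI[of _ "y / d"]) (use that in \<open>simp add: v w a field_simps\<close>)
  \<comment> \<open>If all six minors vanish, w is a multiple of v, with the factor read off at a
    nonzero coordinate of v.\<close>
  have "v1 * w2 - v2 * w1 \<noteq> 0 \<or> v1 * w3 - v3 * w1 \<noteq> 0 \<or> v1 * w4 - v4 * w1 \<noteq> 0 \<or>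
        v2 * w3 - v3 * w2 \<noteq> 0 \<or> v2 * w4 - v4 * w2 \<noteq> 0 \<or> v3 * w4 - v4 * w3 \<noteq> 0"
  proof (rule ccontr)
    assume "\<not> ?thesis"
    then have z: "v1 * w2 = v2 * w1" "v1 * w3 = v3 * w1" "v1 * w4 = v4 * w1"
      "v2 * w3 = v3 * w2" "v2 * w4 = v4 * w2" "v3 * w4 = v4 * w3" by auto
    have "v1 \<noteq> 0 \<or> v2 \<noteq> 0 \<or> v3 \<noteq> 0 \<or> v4 \<noteq> 0" using v0 v by auto
    then have "\<exists>x. w = vscale x v"
    proof (elim disjE)
      assume "v1 \<noteq> 0" then show ?thesis using z by (intro exI[of _ "w1 / v1"]) (simp add: v w field_simps)
    next
      assume "v2 \<noteq> 0" then show ?thesis using z by (intro exI[of _ "w2 / v2"]) (simp add: v w field_simps)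
    next
      assume "v3 \<noteq> 0" then show ?thesis using z by (intro exI[of _ "w3 / v3"]) (simp add: v w field_simps)
    next
      assume "v4 \<noteq> 0" then show ?thesis using z by (intro exI[of _ "w4 / v4"]) (simp add: v w field_simps)
    qed
    then show False using wv by (auto simp: ray_iff)
  qed
  then show ?thesis
  proof (elim disjE)
    assume d: "v1 * w2 - v2 * w1 \<noteq> 0"
    show ?thesis
      by (rule cramer[OF d, of "a1 * w2 - a2 * w1" "v1 * a2 - v2 * a1"]) (algebra | use m(1) in algebra | use m(2) in algebra | use m(3) in algebra | use m(4) in algebra)+
  next
    assume d: "v1 * w3 - v3 * w1 \<noteq> 0"
    show ?thesis
      by (rule cramer[OF d, of "a1 * w3 - a3 * w1" "v1 * a3 - v3 * a1"]) (algebra | use m(1) in algebra | use m(2) in algebra | use m(3) in algebra | use m(4) in algebra)+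
  next
    assume d: "v1 * w4 - v4 * w1 \<noteq> 0"
    show ?thesis
      by (rule cramer[OF d, of "a1 * w4 - a4 * w1" "v1 * a4 - v4 * a1"]) (algebra | use m(1) in algebra | use m(2) in algebra | use m(3) in algebra | use m(4) in algebra)+
  next
    assume d: "v2 * w3 - v3 * w2 \<noteq> 0"
    show ?thesis
      by (rule cramer[OF d, of "a2 * w3 - a3 * w2" "v2 * a3 - v3 * a2"]) (algebra | use m(1) in algebra | use m(2) in algebra | use m(3) in algebra | use m(4) in algebra)+
  next
    assume d: "v2 * w4 - v4 * w2 \<noteq> 0"
    show ?thesis
      by (rule cramer[OF d, of "a2 * w4 - a4 * w2" "v2 * a4 - v4 * a2"]) (algebra | use m(1) in algebra | use m(2) in algebra | use m(3) in algebra | use m(4) in algebra)+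
  next
    assume d: "v3 * w4 - v4 * w3 \<noteq> 0"
    show ?thesis
      by (rule cramer[OF d, of "a3 * w4 - a4 * w3" "v3 * a4 - v4 * a3"]) (algebra | use m(1) in algebra | use m(2) in algebra | use m(3) in algebra | use m(4) in algebra)+
  qed
qed

section \<open>Points and lines of W(q)\<close>

abbreviation sp_points :: "('k::field) vec4 set set" where "sp_points \<equiv> pg_points (*) 0"
abbreviation sp_lines :: "('k::field) vec4 set set" where "sp_lines \<equiv> W_lines (+) uminus (*) 0"

lemma sp_points_iff: "p \<in> sp_points \<longleftrightarrow> (\<exists>a. a \<noteq> vzero \<and> p = ray a)"
  by (auto simp: pg_points_def)

lemma form_plane:
  assumes "form v w = 0" "x \<in> plane v w" "y \<in> plane v w"
  shows "form x y = 0"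
  using assms form_swap[of v w] by (auto simp: plane_iff form_simps)

lemma sp_lines_iff:
  "l \<in> sp_lines \<longleftrightarrow> (\<exists>v w. l = plane v w \<and> v \<noteq> vzero \<and> w \<notin> ray v \<and> form v w = 0)"
proof
  assume "l \<in> sp_lines"
  then show "\<exists>v w. l = plane v w \<and> v \<noteq> vzero \<and> w \<notin> ray v \<and> form v w = 0"
    unfolding W_lines_def pg_lines_def using gens_in_plane by blast
next
  assume "\<exists>v w. l = plane v w \<and> v \<noteq> vzero \<and> w \<notin> ray v \<and> form v w = 0"
  then show "l \<in> sp_lines"
    unfolding W_lines_def pg_lines_def using form_plane by blast
qed

lemma sp_line_isotropic: "l \<in> sp_lines \<Longrightarrow> x \<in> l \<Longrightarrow> y \<in> l \<Longrightarrow> form x y = 0"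
  by (auto simp: W_lines_def)

lemma ray_subset_line: "l \<in> sp_lines \<Longrightarrow> ray a \<subseteq> l \<longleftrightarrow> a \<in> l"
  unfolding sp_lines_iff using ray_subset_plane by blast

lemma line_eq_plane:
  assumes "l \<in> sp_lines" "a \<in> l" "b \<in> l" "a \<noteq> vzero" "b \<notin> ray a"
  shows "l = plane a b"
  using assms plane_exchange unfolding sp_lines_iff by metis

lemma perp_line:
  assumes l: "l \<in> sp_lines" and "b \<in> l" "c \<in> l" "b \<noteq> vzero" "c \<notin> ray b" "form a b = 0" "form a c = 0"
  shows "a \<in> l"
  using perp_subset_plane[of b c a] line_eq_plane[of l b c] sp_line_isotropic[of l b c] assms by simp

lemma vzero_in_ray: "vzero \<in> ray a"
  unfolding ray_iff by (rule exI[of _ 0]) simp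

text \<open>Pairing with a is a linear functional on a 2-space, so it kills a nonzero vector: v
  itself, or the combination \<open>?b\<close>, which is nonzero because v and w are
  independent.\<close>

lemma sp_proj:
  assumes l: "l \<in> sp_lines" and a: "a \<notin> l"
  shows "\<exists>b\<in>l. b \<noteq> vzero \<and> form a b = 0"
proof -
  obtain v w where v: "l = plane v w" "v \<noteq> vzero" "w \<notin> ray v" "form v w = 0"
    using l unfolding sp_lines_iff by blast
  let ?b = "vplus (vscale (form a w) v) (vscale (- form a v) w)"
  show ?thesis
  proof (cases "form a v = 0")
    case True
    then show ?thesis using v gens_in_plane by metis
  next
    case False
    have "?b \<noteq> vzero"
    proof
      assume b0: "?b = vzero"
      have "w = vscale (form a w / form a v) v"
        using b0 False by (cases v; cases w) (simp add: field_simps)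
      then show False using v by (auto simp: ray_iff)
    qed
    moreover have "form a ?b = 0" by (simp add: form_simps)
    moreover have "?b \<in> l" unfolding v plane_iff by blast
    ultimately show ?thesis by blast
  qed
qed

lemma sp_plane_line:
  assumes "a \<noteq> vzero" "b \<notin> ray a" "form a b = 0"
  shows "plane a b \<in> sp_lines"
  using assms sp_lines_iff by blast

section \<open>Counting in W(q)\<close>

lemma two_le_card_field: "2 \<le> CARD('k::{field,finite})"
  using card_mono[of UNIV "{0, 1 :: 'k}"] by simp

lemma card_ray:
  fixes a :: "('k::{field,finite}) vec4"
  assumes "a \<noteq> vzero"
  shows "card (ray a) = CARD('k)"
proof -
  have "ray a = range (\<lambda>x. vscale x a)" by (auto simp: span1_def)
  moreover have "inj (\<lambda>x. vscale x a)"
    using assms by (cases a) (auto simp: inj_def)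
  ultimately show ?thesis by (simp add: card_image)
qed

lemma card_plane:
  fixes v :: "('k::{field,finite}) vec4"
  assumes v: "v \<noteq> vzero" and w: "w \<notin> ray v"
  shows "card (plane v w) = CARD('k)\<^sup>2"
proof -
  let ?f = "\<lambda>z. vplus (vscale (fst z) v) (vscale (snd z) w)"
  have "plane v w = range ?f"
    unfolding set_eq_iff plane_iff image_iff by (metis UNIV_I fst_conv snd_conv)
  moreover have "inj ?f"
  proof (rule injI)
    fix z z' :: "'k \<times> 'k"
    obtain x y x' y' where z: "z = (x, y)" "z' = (x', y')" by (cases z, cases z')
    assume "?f z = ?f z'"
    then have e: "vplus (vscale x v) (vscale y w) = vplus (vscale x' v) (vscale y' w)" by (simp add: z)
    have yy: "y = y'"
    proof (rule ccontr)
      assume "y \<noteq> y'"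
      then have c: "r = (x' - x) * p / (y - y')" if "x * p + y * r = x' * p + y' * r" for p r
      proof -
        have "r * (y - y') = (x' - x) * p" using that by algebra
        then show ?thesis using \<open>y \<noteq> y'\<close> by (simp add: field_simps)
      qed
      have "w = vscale ((x' - x) / (y - y')) v"
        using e by (cases v; cases w) (auto intro!: c)
      then show False using w by (auto simp: ray_iff)
    qed
    then have "vscale (x - x') v = vzero" using e by (cases v; cases w) (simp add: algebra_simps)
    then have "x - x' = 0" using v vscale_eq_vzero by blast
    then show "z = z'" using yy z by simp
  qed
  ultimately have "card (plane v w) = card (UNIV :: ('k \<times> 'k) set)" by (simp add: card_image)
  also have "\<dots> = CARD('k)\<^sup>2"
    unfolding UNIV_Times_UNIV[symmetric] card_cartesian_product by (simp add: power2_eq_square)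
  finally show ?thesis .
qed

text \<open>Fix x with \<open>form a x = 1\<close>. Every vector is b + c x for a unique b
  orthogonal to a and a unique scalar c, so q^4 is q times the number of such b.\<close>

lemma card_perp:
  fixes a :: "('k::{field,finite}) vec4"
  assumes "a \<noteq> vzero"
  shows "card {b. form a b = 0} = CARD('k) ^ 3"
proof -
  \<comment> \<open>Pairing a with the unit vectors returns its coordinates up to sign, so some
    pairing is nonzero.\<close>
  obtain x0 where x0: "form a x0 \<noteq> 0"
  proof -
    obtain a1 a2 a3 a4 where a: "a = (a1, a2, a3, a4)" by (cases a)
    then have "form a (0,1,0,0) = a1" "form a (1,0,0,0) = - a2" "form a (0,0,0,1) = a3" "form a (0,0,1,0) = - a4"
      by simp_all
    then show thesis using that assms a by fastforce
  qed
  define x where "x = vscale (1 / form a x0) x0"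
  have x: "form a x = 1" using x0 by (simp add: x_def form_simps)
  let ?f = "\<lambda>(b, c). vplus b (vscale c x)"
  have "bij_betw ?f ({b. form a b = 0} \<times> UNIV) UNIV"
  proof (rule bij_betw_imageI)
    show "inj_on ?f ({b. form a b = 0} \<times> UNIV)"
    proof (rule inj_onI, clarify)
      fix b c b' c'
      assume b: "form a b = 0" "form a b' = 0" and e: "vplus b (vscale c x) = vplus b' (vscale c' x)"
      have "form a (vplus b (vscale c x)) = form a (vplus b' (vscale c' x))" using e by simp
      then have "c = c'" using b x by (simp add: form_simps)
      then show "b = b' \<and> c = c'" using e by (cases b; cases b'; cases x) simp
    qed
    show "?f ` ({b. form a b = 0} \<times> UNIV) = UNIV"
    proof (rule UNIV_eq_I[symmetric])
      fix y
      let ?b = "vplus y (vscale (- form a y) x)"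
      show "y \<in> ?f ` ({b. form a b = 0} \<times> UNIV)"
      proof (rule image_eqI[of _ _ "(?b, form a y)"])
        show "y = ?f (?b, form a y)" by (cases x; cases y) (simp add: algebra_simps)
        show "(?b, form a y) \<in> {b. form a b = 0} \<times> UNIV" using x by (simp add: form_simps)
      qed
    qed
  qed
  then have "card ({b. form a b = 0} \<times> (UNIV :: 'k set)) = card (UNIV :: 'k vec4 set)"
    by (rule bij_betw_same_card)
  also have "card (UNIV :: 'k vec4 set) = CARD('k) * (CARD('k) * (CARD('k) * CARD('k)))"
    unfolding UNIV_Times_UNIV[symmetric] card_cartesian_product by simp
  finally have "card {b. form a b = 0} * CARD('k) = CARD('k) ^ 3 * CARD('k)"
    by (simp add: card_cartesian_product power3_eq_cube)
  then show ?thesis using card_gt_0_iff[of "UNIV :: 'k set"] by simp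
qed


text \<open>With zero removed, the rays in l partition its q^2 - 1 nonzero vectors into sets of size
  q - 1.\<close>

lemma card_points_on_line:
  fixes l :: "('k::{field,finite}) vec4 set"
  assumes l: "l \<in> sp_lines"
  shows "card {p \<in> sp_points. p \<subseteq> l} = CARD('k) + 1"
proof -
  obtain v w where v: "l = plane v w" "v \<noteq> vzero" "w \<notin> ray v" using l unfolding sp_lines_iff by blast
  let ?P = "{p \<in> sp_points. p \<subseteq> l}"
  let ?C = "(\<lambda>p. p - {vzero}) ` ?P"
  have P: "\<exists>a\<in>l. a \<noteq> vzero \<and> p = ray a" if "p \<in> ?P" for p
    using that self_in_ray unfolding sp_points_iff by blast
  have inj: "inj_on (\<lambda>p. p - {vzero}) ?P"
  proof (rule inj_onI)
    fix p q assume pq: "p \<in> ?P" "q \<in> ?P" "p - {vzero} = q - {vzero}"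
    have "vzero \<in> p" "vzero \<in> q" using P[OF pq(1)] P[OF pq(2)] vzero_in_ray by blast+
    then show "p = q" using pq(3) by blast
  qed
  have "(CARD('k) - 1) * card ?C = card (\<Union>?C)"
  proof (rule card_partition)
    show "finite ?C" "finite (\<Union>?C)" by simp_all
    show "card c = CARD('k) - 1" if c: "c \<in> ?C" for c
    proof -
      obtain a where "a \<noteq> vzero" "c = ray a - {vzero}" using c P by blast
      then show ?thesis using card_ray[of a] vzero_in_ray[of a] by simp
    qed
    show "c \<inter> d = {}" if cd: "c \<in> ?C" "d \<in> ?C" "c \<noteq> d" for c d
    proof (rule ccontr)
      assume "c \<inter> d \<noteq> {}"
      then obtain b where b: "b \<in> c" "b \<in> d" by blast
      obtain a where "c = ray a - {vzero}" using cd P by blast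
      moreover obtain a' where "d = ray a' - {vzero}" using cd P by blast
      ultimately show False using b cd ray_eq[of b a] ray_eq[of b a'] by auto
    qed
  qed
  moreover have "\<Union>?C = l - {vzero}"
  proof
    show "l - {vzero} \<subseteq> \<Union>?C"
    proof
      fix b assume b: "b \<in> l - {vzero}"
      then have "ray b \<in> ?P" using ray_subset_line[OF l] unfolding sp_points_iff by blast
      moreover have "b \<in> ray b - {vzero}" using b self_in_ray[of b] by blast
      ultimately show "b \<in> \<Union>?C" by blast
    qed
  qed blast
  moreover have "card (l - {vzero}) = CARD('k)\<^sup>2 - 1"
    using card_plane[OF v(2,3)] v ray_subset_line[OF l, of vzero] ray_subset_plane[of vzero v w] vzero_in_ray[of v]
      gens_in_plane(1)[of v w] ray_subset_plane[of v v w] by (subst card_Diff_singleton) auto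
  ultimately have e: "(CARD('k) - 1) * card ?P = CARD('k)\<^sup>2 - 1" using card_image[OF inj] by simp
  \<comment> \<open>With q = j + 2 the truncated subtractions disappear and the factor j + 1 can be
    cancelled.\<close>
  obtain j where j: "CARD('k) = j + 2"
    using le_Suc_ex[OF two_le_card_field[where 'k = 'k]] by (metis add.commute)
  then have "(j + 1) * card ?P = (j + 1) * (j + 3)" using e by (simp add: power2_eq_square algebra_simps)
  then have "card ?P = j + 3" unfolding mult_cancel1 by simp
  then show ?thesis using j by simp
qed

text \<open>With p removed, the lines through p partition the rest of its orthogonal space: sets of
  size q^2 - q in a set of size q^3 - q.\<close>

lemma card_lines_on_point:
  fixes p :: "('k::{field,finite}) vec4 set"
  assumes p: "p \<in> sp_points"
  shows "card {l \<in> sp_lines. p \<subseteq> l} = CARD('k) + 1"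
proof -
  obtain a where a: "a \<noteq> vzero" "p = ray a" using p unfolding sp_points_iff by blast
  let ?L = "{l \<in> sp_lines. p \<subseteq> l}"
  let ?C = "(\<lambda>l. l - p) ` ?L"
  have L: "a \<in> l" if "l \<in> ?L" for l using that a self_in_ray by blast
  have inj: "inj_on (\<lambda>l. l - p) ?L"
    by (rule inj_onI) blast
  have "(CARD('k)\<^sup>2 - CARD('k)) * card ?C = card (\<Union>?C)"
  proof (rule card_partition)
    show "finite ?C" "finite (\<Union>?C)" by simp_all
    show "card c = CARD('k)\<^sup>2 - CARD('k)" if c: "c \<in> ?C" for c
    proof -
      obtain l where l: "l \<in> sp_lines" "p \<subseteq> l" "c = l - p" using c by blast
      obtain v w where v: "l = plane v w" "v \<noteq> vzero" "w \<notin> ray v" using l unfolding sp_lines_iff by blast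
      show ?thesis using l card_ray[OF a(1)] card_plane[OF v(2,3)] v a by (simp add: card_Diff_subset)
    qed
    show "c \<inter> d = {}" if cd: "c \<in> ?C" "d \<in> ?C" "c \<noteq> d" for c d
    proof (rule ccontr)
      assume "c \<inter> d \<noteq> {}"
      then obtain b where b: "b \<in> c" "b \<in> d" by blast
      obtain l where l: "l \<in> ?L" "c = l - p" using cd by blast
      obtain m where m: "m \<in> ?L" "d = m - p" using cd by blast
      have "l = plane a b" using line_eq_plane[of l a b] l L[OF l(1)] a b by auto
      moreover have "m = plane a b" using line_eq_plane[of m a b] m L[OF m(1)] a b by auto
      ultimately show False using cd l m by simp
    qed
  qed
  moreover have "\<Union>?C = {b. form a b = 0} - p"
  proof
    show "\<Union>?C \<subseteq> {b. form a b = 0} - p" using sp_line_isotropic L by blast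
    show "{b. form a b = 0} - p \<subseteq> \<Union>?C"
    proof
      fix b assume b: "b \<in> {b. form a b = 0} - p"
      then have l: "plane a b \<in> sp_lines" using sp_plane_line[of a b] a by blast
      moreover have "p \<subseteq> plane a b" using ray_subset_line[OF l] gens_in_plane a by blast
      ultimately show "b \<in> \<Union>?C" using b gens_in_plane(2)[of b a] by blast
    qed
  qed
  moreover have "card ({b. form a b = 0} - p) = CARD('k) ^ 3 - CARD('k)"
  proof (subst card_Diff_subset)
    show "p \<subseteq> {b. form a b = 0}" unfolding a using form_self[of a] by (auto simp: ray_iff form_vscale_right simp del: symp.simps)
    show "finite p" by simp
    show "card {b. form a b = 0} - card p = CARD('k) ^ 3 - CARD('k)" using card_perp[OF a(1)] card_ray[OF a(1)] a by simp
  qed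
  ultimately have e: "(CARD('k)\<^sup>2 - CARD('k)) * card ?L = CARD('k) ^ 3 - CARD('k)" using card_image[OF inj] by simp
  obtain j where j: "CARD('k) = j + 2"
    using le_Suc_ex[OF two_le_card_field[where 'k = 'k]] by (metis add.commute)
  have "(j + 2)\<^sup>2 - (j + 2) = (j + 2) * (j + 1)" "(j + 2) ^ 3 - (j + 2) = (j + 2) * (j + 1) * (j + 3)"
    by (simp_all add: power2_eq_square power3_eq_cube algebra_simps)
  then have "(j + 2) * (j + 1) * card ?L = (j + 2) * (j + 1) * (j + 3)" using e j by simp
  then have "card ?L = j + 3" unfolding mult_cancel1 by simp
  then show ?thesis using j by simp
qed

theorem symplectic_gen_quadrangle:
  "gen_quadrangle (sp_points :: ('k::{field,finite}) vec4 set set) sp_lines (\<subseteq>) (CARD('k) + 1)"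
proof
  fix p q l m :: "'k vec4 set"
  assume p: "p \<in> sp_points" and q: "q \<in> sp_points" and l: "l \<in> sp_lines" and m: "m \<in> sp_lines"
    and i: "p \<subseteq> l" "q \<subseteq> l" "p \<subseteq> m" "q \<subseteq> m"
  obtain a b where a: "a \<noteq> vzero" "p = ray a" and b: "b \<noteq> vzero" "q = ray b"
    using p q unfolding sp_points_iff by blast
  have ab: "a \<in> l" "b \<in> l" "a \<in> m" "b \<in> m" using i a b self_in_ray by blast+
  show "p = q \<or> l = m"
  proof (cases "b \<in> ray a")
    case True then show ?thesis using ray_eq a b by blast
  next
    case False then show ?thesis using line_eq_plane[OF l ab(1,2) a(1)] line_eq_plane[OF m ab(3,4) a(1)] by simp
  qed
next
  fix p l :: "'k vec4 set"
  assume p: "p \<in> sp_points" and l: "l \<in> sp_lines" and n: "\<not> p \<subseteq> l"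
  obtain a where a: "a \<noteq> vzero" "p = ray a" using p unfolding sp_points_iff by blast
  have al: "a \<notin> l" using ray_subset_line[OF l] n a by blast
  then obtain b where b: "b \<in> l" "b \<noteq> vzero" "form a b = 0" using sp_proj[OF l] by blast
  have "b \<notin> ray a" using ray_eq[OF _ b(2), of a] ray_subset_line[OF l, of b] b al self_in_ray by blast
  then have m: "plane a b \<in> sp_lines" using sp_plane_line a b by blast
  show "\<exists>q\<in>sp_points. \<exists>m\<in>sp_lines. p \<subseteq> m \<and> q \<subseteq> m \<and> q \<subseteq> l"
  proof (rule bexI[of _ "ray b"], rule bexI[OF _ m], intro conjI)
    show "p \<subseteq> plane a b" "ray b \<subseteq> plane a b" using ray_subset_plane gens_in_plane a by blast+
    show "ray b \<subseteq> l" using ray_subset_line[OF l] b by blast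
    show "ray b \<in> sp_points" using b sp_points_iff by blast
  qed
next
  fix p l q m q' m' :: "'k vec4 set"
  assume p: "p \<in> sp_points" and l: "l \<in> sp_lines" and n: "\<not> p \<subseteq> l"
    and q: "q \<in> sp_points" and m: "m \<in> sp_lines" and i: "p \<subseteq> m" "q \<subseteq> m" "q \<subseteq> l"
    and q': "q' \<in> sp_points" and m': "m' \<in> sp_lines" and i': "p \<subseteq> m'" "q' \<subseteq> m'" "q' \<subseteq> l"
  obtain a b c where a: "a \<noteq> vzero" "p = ray a" and b: "b \<noteq> vzero" "q = ray b" and c: "c \<noteq> vzero" "q' = ray c"
    using p q q' unfolding sp_points_iff by blast
  have al: "a \<notin> l" using ray_subset_line[OF l] n a by blast
  have ins: "a \<in> m" "b \<in> m" "b \<in> l" "a \<in> m'" "c \<in> m'" "c \<in> l" using i i' a b c self_in_ray by blast+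
  have "form a b = 0" "form a c = 0" using sp_line_isotropic m m' ins by blast+
  \<comment> \<open>Otherwise b and c span l, and a is orthogonal to both and so lies in l.\<close>
  then have "c \<in> ray b" using perp_line[OF l ins(3,6) b(1)] al by blast
  then have qq: "ray c = ray b" using ray_eq c by blast
  have "b \<notin> ray a" using ray_eq[OF _ b(1), of a] ray_subset_line[OF l, of b] ins al self_in_ray by blast
  moreover have "b \<in> m'" using qq i' c self_in_ray by blast
  ultimately have "m = plane a b" "m' = plane a b" using line_eq_plane m m' ins a by blast+
  then show "q = q' \<and> m = m'" using qq b c by simp
next
  show "3 \<le> CARD('k) + 1" using two_le_card_field[where 'k = 'k] by simp
  show "(sp_points :: 'k vec4 set set) \<noteq> {}" using sp_points_iff[of "ray (1,0,0,0)"] by force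
  have "(0,0,1,0) \<notin> ray ((1,0,0,0) :: 'k vec4)" by (auto simp: ray_iff)
  then have "plane (1,0,0,0) (0,0,1,0) \<in> (sp_lines :: 'k vec4 set set)" by (intro sp_plane_line) auto
  then show "(sp_lines :: 'k vec4 set set) \<noteq> {}" by blast
qed (use card_points_on_line card_lines_on_point in auto)

section \<open>Transfer to coded fields and to isomorphic copies\<close>

lemma gen_quadrangle_of_image:
  assumes gq: "gen_quadrangle (image g ` Pt) (image g ` Ln) (\<subseteq>) k" and inj: "inj g"
  shows "gen_quadrangle Pt Ln (\<subseteq>) k"
proof -
  interpret G: gen_quadrangle "image g ` Pt" "image g ` Ln" "(\<subseteq>)" k by fact
  have sub: "g ` a \<subseteq> g ` b \<longleftrightarrow> a \<subseteq> b" for a b using inj by (rule inj_image_subset_iff)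
  have eq: "g ` a = g ` b \<longleftrightarrow> a = b" for a b using inj by (rule inj_image_eq_iff)
  have inj': "inj_on (image g) A" for A by (rule inj_onI) (simp add: eq)
  show ?thesis
  proof
    fix p q l m assume "p \<in> Pt" "q \<in> Pt" "l \<in> Ln" "m \<in> Ln" "p \<subseteq> l" "q \<subseteq> l" "p \<subseteq> m" "q \<subseteq> m"
    then show "p = q \<or> l = m" using G.join_unique[of "g ` p" "g ` q" "g ` l" "g ` m"] by (simp add: sub eq)
  next
    fix p l assume "p \<in> Pt" "l \<in> Ln" "\<not> p \<subseteq> l"
    then show "\<exists>q\<in>Pt. \<exists>m\<in>Ln. p \<subseteq> m \<and> q \<subseteq> m \<and> q \<subseteq> l"
      using G.proj_ex[of "g ` p" "g ` l"] by (simp add: sub)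
  next
    fix p l q m q' m'
    assume "p \<in> Pt" "l \<in> Ln" "\<not> p \<subseteq> l" "q \<in> Pt" "m \<in> Ln" "p \<subseteq> m" "q \<subseteq> m" "q \<subseteq> l"
      "q' \<in> Pt" "m' \<in> Ln" "p \<subseteq> m'" "q' \<subseteq> m'" "q' \<subseteq> l"
    then show "q = q' \<and> m = m'"
      using G.proj_unique[of "g ` p" "g ` l" "g ` q" "g ` m" "g ` q'" "g ` m'"] by (simp add: sub eq)
  next
    fix l assume l: "l \<in> Ln"
    have "{p \<in> image g ` Pt. p \<subseteq> g ` l} = image g ` {p \<in> Pt. p \<subseteq> l}" by (auto simp: sub)
    then show "card {p \<in> Pt. p \<subseteq> l} = k" using G.card_line[of "g ` l"] l by (simp add: card_image[OF inj'])
  next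
    fix p assume p: "p \<in> Pt"
    have "{l \<in> image g ` Ln. g ` p \<subseteq> l} = image g ` {l \<in> Ln. p \<subseteq> l}" by (auto simp: sub)
    then show "card {l \<in> Ln. p \<subseteq> l} = k" using G.card_pencil[of "g ` p"] p by (simp add: card_image[OF inj'])
  qed (use G.k_ge_3 G.Pt_nonempty G.Ln_nonempty in auto)
qed

text \<open>The map e is an isomorphism from the explicit operations to a type of class
  \<open>field\<close>. Applied to coordinates it carries over rays, 2-spaces and the form, so the
  quadrangle axioms can be pulled back.\<close>

lemma W_gen_quadrangle:
  fixes e :: "'f \<Rightarrow> 'k::{field,finite}"
  assumes bij: "bij e"
    and ad: "\<And>x y. e (ad x y) = e x + e y" and ng: "\<And>x. e (ng x) = - e x"
    and mu: "\<And>x y. e (mu x y) = e x * e y" and z: "e z = 0"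
  shows "gen_quadrangle (pg_points mu z) (W_lines ad ng mu z) (\<subseteq>) (CARD('k) + 1)"
proof -
  define g where "g = (\<lambda>(a, b, c, d). (e a, e b, e c, e d))"
  have g_simp: "g (a, b, c, d) = (e a, e b, e c, e d)" for a b c d by (simp add: g_def)
  have inj: "inj g" using bij_is_inj[OF bij] unfolding inj_def by (simp add: g_simp)
  have surj: "\<exists>v'. v = g v'" for v
  proof -
    obtain v1 v2 v3 v4 where v: "v = (v1, v2, v3, v4)" by (cases v)
    obtain u1 u2 u3 u4 where "v1 = e u1" "v2 = e u2" "v3 = e u3" "v4 = e u4"
      using bij_is_surj[OF bij] by (metis surjD)
    then have "v = g (u1, u2, u3, u4)" by (simp add: v g_simp)
    then show ?thesis by blast
  qed
  have g_add: "g (vadd ad a b) = vplus (g a) (g b)" for a b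
    by (cases a; cases b) (simp add: g_simp ad)
  have g_smul: "g (smul mu x a) = vscale (e x) (g a)" for x a
    by (cases a) (simp add: g_simp mu)
  have g_symp: "e (symp ad ng mu a b) = form (g a) (g b)" for a b
    by (cases a; cases b) (simp add: g_simp ad ng mu)
  have g_zero: "g v = vzero \<longleftrightarrow> v = (z, z, z, z)" for v
    using inj_eq[OF inj, of v "(z, z, z, z)"] by (simp add: g_simp z)
  have e_zero: "e x = 0 \<longleftrightarrow> x = z" for x using inj_eq[OF bij_is_inj[OF bij], of x z] z by simp
  have ex_e: "(\<exists>x. P (e x)) \<longleftrightarrow> (\<exists>x. P x)" for P using bij_is_surj[OF bij] by (metis surjD)
  have g_ray: "g ` span1 mu v = ray (g v)" for v
  proof -
    have "g ` span1 mu v = {vscale (e x) (g v) | x. True}"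
      unfolding span1_def by (auto simp: g_smul[symmetric])
    also have "\<dots> = ray (g v)" unfolding span1_def using ex_e[of "\<lambda>x. _ = vscale x (g v)"] by simp
    finally show ?thesis .
  qed
  have g_plane: "g ` span2 ad mu v w = plane (g v) (g w)" for v w
  proof -
    have "g ` span2 ad mu v w = {vplus (vscale (e x) (g v)) (vscale (e y) (g w)) | x y. True}"
      unfolding span2_def g_smul[symmetric] g_add[symmetric] by blast
    also have "\<dots> = plane (g v) (g w)" unfolding span2_def set_eq_iff mem_Collect_eq
      using bij_is_surj[OF bij] by (metis surjD)
    finally show ?thesis .
  qed
  have pts: "image g ` pg_points mu z = sp_points"
  proof
    show "image g ` pg_points mu z \<subseteq> sp_points"
    proof
      fix p assume "p \<in> image g ` pg_points mu z"
      then obtain v where "v \<noteq> (z, z, z, z)" "p = g ` span1 mu v" unfolding pg_points_def by blast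
      then show "p \<in> sp_points" unfolding sp_points_iff using g_ray g_zero by blast
    qed
    show "sp_points \<subseteq> image g ` pg_points mu z"
    proof
      fix p :: "'k vec4 set" assume "p \<in> sp_points"
      then obtain v where v: "v \<noteq> vzero" "p = ray v" unfolding sp_points_iff by blast
      obtain v' where v': "v = g v'" using surj by blast
      then have "p = g ` span1 mu v'" using v g_ray by simp
      moreover have "span1 mu v' \<in> pg_points mu z"
        using v v' g_zero[of v'] unfolding pg_points_def by blast
      ultimately show "p \<in> image g ` pg_points mu z" by blast
    qed
  qed
  have iso: "(\<forall>x\<in>span2 ad mu v w. \<forall>y\<in>span2 ad mu v w. symp ad ng mu x y = z) \<longleftrightarrow>
      (\<forall>x\<in>plane (g v) (g w). \<forall>y\<in>plane (g v) (g w). form x y = 0)" for v w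
    unfolding g_plane[symmetric] by (simp add: g_symp[symmetric] e_zero)
  have ray_mem: "g w \<in> ray (g v) \<longleftrightarrow> w \<in> span1 mu v" for v w
    unfolding g_ray[symmetric] using inj by (rule inj_image_mem_iff)
  have lns: "image g ` W_lines ad ng mu z = sp_lines"
  proof
    show "image g ` W_lines ad ng mu z \<subseteq> sp_lines"
    proof
      fix l assume "l \<in> image g ` W_lines ad ng mu z"
      then obtain v w where v: "l = g ` span2 ad mu v w" "v \<noteq> (z,z,z,z)" "w \<notin> span1 mu v"
          "\<forall>x\<in>span2 ad mu v w. \<forall>y\<in>span2 ad mu v w. symp ad ng mu x y = z"
        unfolding W_lines_def pg_lines_def by blast
      then have "l = plane (g v) (g w)" "g v \<noteq> vzero" "g w \<notin> ray (g v)"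
        "\<forall>x\<in>plane (g v) (g w). \<forall>y\<in>plane (g v) (g w). form x y = 0"
        using g_plane g_zero ray_mem iso by auto
      then show "l \<in> sp_lines" unfolding W_lines_def pg_lines_def by blast
    qed
    show "sp_lines \<subseteq> image g ` W_lines ad ng mu z"
    proof
      fix l :: "'k vec4 set" assume "l \<in> sp_lines"
      then obtain v w where v: "l = plane v w" "v \<noteq> vzero" "w \<notin> ray v"
          "\<forall>x\<in>plane v w. \<forall>y\<in>plane v w. form x y = 0"
        unfolding W_lines_def pg_lines_def by blast
      obtain v' w' where g: "v = g v'" "w = g w'" using surj by metis
      have "span2 ad mu v' w' \<in> W_lines ad ng mu z"
        using v iso[of v' w'] g_zero[of v'] ray_mem[of w' v'] unfolding g W_lines_def pg_lines_def by blast
      moreover have "l = g ` span2 ad mu v' w'" using v g g_plane by simp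
      ultimately show "l \<in> image g ` W_lines ad ng mu z" by blast
    qed
  qed
  show ?thesis
    by (rule gen_quadrangle_of_image[OF _ inj]) (simp only: pts lns symplectic_gen_quadrangle)
qed

text \<open>The two components of the flag \<open>f x\<close> serve as the labels \<open>pt\<close>
  and \<open>ln\<close> of x.\<close>

lemma gated_octagon_of_iso:
  assumes gq: "gen_quadrangle (pg_points mu z) (W_lines ad ng mu z) (\<subseteq>) k"
    and iso: "iso_is \<Omega> (flag_octagon ad ng mu z)" and sub: "\<And>b. b \<in> snd \<Omega> \<Longrightarrow> b \<subseteq> fst \<Omega>"
  shows "gated_octagon k \<Omega>"
proof -
  let ?W = "flag_octagon ad ng mu z"
  obtain f where bij: "bij_betw f (fst \<Omega>) (fst ?W)" and img: "image f ` snd \<Omega> = snd ?W"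
    using iso by (auto simp: iso_is_def)
  have fW: "fst ?W = W_flags ad ng mu z" by (simp add: flag_octagon_def)
  have f_in: "f x \<in> W_flags ad ng mu z" if "x \<in> fst \<Omega>" for x
    using bij that unfolding fW bij_betw_def by blast
  have inj: "inj_on f (fst \<Omega>)" using bij by (rule bij_betw_imp_inj_on)
  \<comment> \<open>An isomorphism speaks only of the images of blocks. As blocks consist of points
    and f is injective on points, each block is the preimage of its image.\<close>
  have pre: "snd \<Omega> = (\<lambda>c. {x \<in> fst \<Omega>. f x \<in> c}) ` snd ?W"
  proof -
    have "{x \<in> fst \<Omega>. f x \<in> f ` b} = b" if "b \<in> snd \<Omega>" for b
      using sub[OF that] inj unfolding inj_on_def by blast
    then show ?thesis unfolding img[symmetric] image_image by simp
  qed
  interpret gen_quadrangle "pg_points mu z" "W_lines ad ng mu z" "(\<subseteq>)" k by fact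
  have "flag_system (pg_points mu z) (W_lines ad ng mu z) (\<subseteq>) k \<Omega> (fst \<circ> f) (snd \<circ> f)"
  proof
    fix x assume "x \<in> fst \<Omega>"
    from f_in[OF this] show "(fst \<circ> f) x \<in> pg_points mu z" "(snd \<circ> f) x \<in> W_lines ad ng mu z"
      "(fst \<circ> f) x \<subseteq> (snd \<circ> f) x"
      by (auto simp: W_flags_def)
  next
    fix x y assume "x \<in> fst \<Omega>" "y \<in> fst \<Omega>" "(fst \<circ> f) x = (fst \<circ> f) y" "(snd \<circ> f) x = (snd \<circ> f) y"
    then show "x = y" using inj by (simp add: inj_on_def prod_eq_iff)
  next
    fix p l assume "p \<in> pg_points mu z" "l \<in> W_lines ad ng mu z" "p \<subseteq> l"
    then have "(p, l) \<in> f ` fst \<Omega>" using bij unfolding fW bij_betw_def by (simp add: W_flags_def)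
    then obtain x where "x \<in> fst \<Omega>" "f x = (p, l)" by force
    then show "\<exists>x\<in>fst \<Omega>. (fst \<circ> f) x = p \<and> (snd \<circ> f) x = l" by (intro bexI[of _ x]) simp_all
  next
    have 1: "{x \<in> fst \<Omega>. f x \<in> {h \<in> W_flags ad ng mu z. fst h = p}} = {x \<in> fst \<Omega>. (fst \<circ> f) x = p}" for p
      using f_in by auto
    have 2: "{x \<in> fst \<Omega>. f x \<in> {h \<in> W_flags ad ng mu z. snd h = l}} = {x \<in> fst \<Omega>. (snd \<circ> f) x = l}" for l
      using f_in by auto
    have 3: "(\<lambda>c. {x \<in> fst \<Omega>. f x \<in> c}) ` {F p |p. p \<in> S} = {{x \<in> fst \<Omega>. f x \<in> F p} |p. p \<in> S}"
      for F and S :: "'s set" by blast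
    show "snd \<Omega> = {{x \<in> fst \<Omega>. (fst \<circ> f) x = p} |p. p \<in> pg_points mu z} \<union>
        {{x \<in> fst \<Omega>. (snd \<circ> f) x = l} |l. l \<in> W_lines ad ng mu z}"
      unfolding pre unfolding flag_octagon_def snd_conv image_Un 3 1 2 ..
  qed
  then show ?thesis by (rule gated_octagon_flag_system)
qed

section \<open>The fields with 2 and 4 elements\<close>

instance bit :: finite
proof
  have "UNIV \<subseteq> range (of_bool :: bool \<Rightarrow> bit)"
  proof
    fix x :: bit show "x \<in> range of_bool" by (cases x) (auto intro: range_eqI[of _ _ False] range_eqI[of _ _ True])
  qed
  then show "finite (UNIV :: bit set)" by (rule finite_subset) simp
qed

text \<open>Exclusive or and conjunction become addition and multiplication of \<open>bit\<close>;
  in characteristic 2 the negation is \<open>id\<close>.\<close>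

lemma W2_gen_quadrangle:
  "gen_quadrangle (pg_points (\<and>) False) (W_lines (\<lambda>x y. x \<noteq> y) id (\<and>) False) (\<subseteq>) (CARD(bit) + 1)"
proof (rule W_gen_quadrangle[of "of_bool :: bool \<Rightarrow> bit"])
  show "bij (of_bool :: bool \<Rightarrow> bit)"
  proof (rule bijI)
    show "inj (of_bool :: bool \<Rightarrow> bit)" by (auto simp: inj_def)
    show "surj (of_bool :: bool \<Rightarrow> bit)"
      unfolding surj_def by (metis bit.exhaust of_bool_eq(1) of_bool_eq(2))
  qed
qed (auto simp: of_bool_def)

text \<open>\<open>GF4 a b\<close> stands for a + b omega with omega^2 = omega + 1. A type of its
  own can be made an instance of \<open>field\<close>, as \<open>W_gen_quadrangle\<close>
  demands.\<close>

datatype gf4 = GF4 bool bool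

instantiation gf4 :: field
begin
definition "0 = GF4 False False"
definition "1 = GF4 True False"
fun plus_gf4 where "GF4 a b + GF4 c d = GF4 (a \<noteq> c) (b \<noteq> d)"
fun times_gf4 where
  "GF4 a b * GF4 c d = GF4 ((a \<and> c) \<noteq> (b \<and> d)) (((a \<and> d) \<noteq> (b \<and> c)) \<noteq> (b \<and> d))"
definition "- (x :: gf4) = x"
definition "(x :: gf4) - y = x + y"
text \<open>Nonzero elements satisfy x^3 = 1, so the square is the inverse; it also sends 0 to 0, as
  the class requires.\<close>

definition "inverse (x :: gf4) = x * x"
definition "(x :: gf4) div y = x * (y * y)"
instance
proof
  fix a b c :: gf4
  show "a + b + c = a + (b + c)" by (cases a; cases b; cases c) auto
  show "a + b = b + a" by (cases a; cases b) auto
  show "0 + a = a" by (cases a) (auto simp: zero_gf4_def)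
  show "- a + a = 0" by (cases a) (auto simp: zero_gf4_def uminus_gf4_def)
  show "a - b = a + - b" by (simp add: minus_gf4_def uminus_gf4_def)
  show "a * b * c = a * (b * c)" by (cases a; cases b; cases c) auto
  show "a * b = b * a" by (cases a; cases b) auto
  show "1 * a = a" by (cases a) (auto simp: one_gf4_def)
  show "(a + b) * c = a * c + b * c" by (cases a; cases b; cases c) auto
  show "(0 :: gf4) \<noteq> 1" by (auto simp: zero_gf4_def one_gf4_def)
  show "a \<noteq> 0 \<Longrightarrow> inverse a * a = 1" by (cases a) (auto simp: zero_gf4_def one_gf4_def inverse_gf4_def)
  show "a div b = a * inverse b" by (simp add: divide_gf4_def inverse_gf4_def)
  show "inverse (0 :: gf4) = 0" by (auto simp: zero_gf4_def inverse_gf4_def)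
qed
end

lemma bij_GF4: "bij (\<lambda>(a, b). GF4 a b)"
proof (rule bijI)
  show "inj (\<lambda>(a, b). GF4 a b)" by (auto simp: inj_def)
  show "surj (\<lambda>(a, b). GF4 a b)" unfolding surj_def by (metis gf4.exhaust case_prod_conv)
qed

instance gf4 :: finite
  by standard (use bij_GF4 finite_UNIV_surj_inj in \<open>metis bij_is_surj finite finite_imageI\<close>)

lemma W4_gen_quadrangle:
  "gen_quadrangle (pg_points gf4_mul (False, False)) (W_lines gf4_add id gf4_mul (False, False)) (\<subseteq>) (CARD(gf4) + 1)"
  by (rule W_gen_quadrangle[OF bij_GF4]) (auto simp: uminus_gf4_def zero_gf4_def)

section \<open>The two classes of extended octagons\<close>

lemma extended_octagonI:
  assumes ext: "extension_of \<Delta> (flag_octagon ad ng mu z)" and tri: "triangle_cond \<Delta>"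
    and gq: "gen_quadrangle (pg_points mu z) (W_lines ad ng mu z) (\<subseteq>) k"
  shows "extended_octagon \<Delta> k"
proof
  show inc: "incidence_system \<Delta>" using ext by (simp add: extension_of_def)
  show "triangle_cond \<Delta>" by fact
  fix n assume "n \<in> fst \<Delta>"
  then have "iso_is (residue \<Delta> n) (flag_octagon ad ng mu z)" using ext by (simp add: extension_of_def)
  moreover have "b \<subseteq> fst (residue \<Delta> n)" if b: "b \<in> snd (residue \<Delta> n)" for b
  proof -
    obtain B where B: "B \<in> snd \<Delta>" "n \<in> B" "b = B - {n}" using b by (auto simp: residue_def)
    then have "B \<subseteq> fst \<Delta>" using inc by (simp add: incidence_system_def)
    then show ?thesis using B unfolding fst_residue adjacent_def by blast
  qed
  ultimately show "gated_octagon k (residue \<Delta> n)" by (rule gated_octagon_of_iso[OF gq])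
qed

text \<open>The parameter k is 5 for W(4)^F and 3 for W(2)^F. Connectedness supplies a point of
  \<open>\<Gamma>\<close> and a point in each residue.\<close>

theorem theoremB:
  fixes \<Gamma> :: "'a incsys"
  assumes "incidence_system \<Gamma>"
    and "connected_is \<Gamma>"
    and "\<forall>u\<in>fst \<Gamma>. ext_oct_He (residue \<Gamma> u) \<or> ext_oct_L34 (residue \<Gamma> u)"
  shows False
proof (rule no_extension_of_extended_octagons[OF assms(1)])
  show "fst \<Gamma> \<noteq> {}" using assms(2) by (simp add: connected_is_def)
  fix u assume "u \<in> fst \<Gamma>"
  then consider "ext_oct_He (residue \<Gamma> u)" | "ext_oct_L34 (residue \<Gamma> u)" using assms(3) by blast
  then show "fst (residue \<Gamma> u) \<noteq> {} \<and> (\<exists>k. extended_octagon (residue \<Gamma> u) k)"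
  proof cases
    case 1
    then have "extended_octagon (residue \<Gamma> u) (CARD(gf4) + 1)"
      by (intro extended_octagonI[OF _ _ W4_gen_quadrangle]) (simp_all add: ext_oct_He_def W4F_def)
    then show ?thesis using 1 by (auto simp: ext_oct_He_def extension_of_def connected_is_def)
  next
    case 2
    then have "extended_octagon (residue \<Gamma> u) (CARD(bit) + 1)"
      by (intro extended_octagonI[OF _ _ W2_gen_quadrangle]) (simp_all add: ext_oct_L34_def W2F_def)
    then show ?thesis using 2 by (auto simp: ext_oct_L34_def extension_of_def connected_is_def)
  qed
qed

end
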